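(* There is an algorithm, with running time polynomial in $n$, which takes as input the pairwise distance set $W=\{|a-b| : a,b\in V\}$ of a finite set of integers $V$ (the parameters $n$ and $k$ may also be supplied), and which has the following guarantee. For every $\epsilon>0$ and every $\delta>0$, and every integer-valued function $k=k(n)$ with $k=O(n^{1/2-\epsilon})$, there exists $n(\epsilon,\delta)$ such that for all $n>n(\epsilon,\delta)$: if $V$ is a $k$-element subset of $\{0,1,\dots,n-1\}$ chosen uniformly at random (so that $n\geq \max W$), then with probability greater than $1-\delta$, $V$ is recovered uniquely up to linear shift and reversal from $W$; that is, with probability greater than $1-\delta$, every set of integers whose pairwise distance set equals $W$ is of the form $c+V$ or $c-V$ for some integer $c$, and the algorithm outputs a set of this form.
   Context: For a finite set of integers $V$, its pairwise distance set is $W=\{|a-b| : a,b\in V\}$ (this includes $0$). For an integer $c$, $c+V=\{c+v:v\in V\}$ and $c-V=\{c-v:v\in V\}$; sets of the form $c\pm V$ have the same pairwise distance set as $V$ and are regarded as equivalent to $V$. *)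

theory Defs
  imports
    "HOL-Probability.Probability"
    "HOL-Library.Landau_Symbols"
    "HOL-Computational_Algebra.Polynomial"
begin

definition dist_set :: "int set \<Rightarrow> int set" where
  "dist_set V = {\<bar>a - b\<bar> | a b. a \<in> V \<and> b \<in> V}"

definition shift_reflect :: "int set \<Rightarrow> int set \<Rightarrow> bool" where
  "shift_reflect V U \<longleftrightarrow> (\<exists>c. U = (\<lambda>v. c + v) ` V \<or> U = (\<lambda>v. c - v) ` V)"

text \<open>
  Algorithms are programs of a structured random access machine. The memory consists of integer
  arrays with integer addresses, one for each name; a scalar variable is the cell at address 0 of
  an array. The only arithmetic operations are addition and subtraction, and time is counted with
  unit cost per assignment and per test. A program contains finitely many expressions, so
  evaluating one takes a bounded number of machine operations, and each assignment raises the
  bit length of the largest number in memory by at most a constant. Hence polynomial time here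
  agrees with polynomial time on Turing machines.
\<close>

type_synonym memory = "string \<Rightarrow> int \<Rightarrow> int"

datatype aexp =
    Const int
  | Load string aexp
  | Add aexp aexp
  | Sub aexp aexp

datatype bexp =
    Less aexp aexp
  | Neg bexp
  | Conj bexp bexp

datatype com =
    Skip
  | Store string aexp aexp
  | Seq com com
  | Cond bexp com com
  | While bexp com

primrec aval :: "aexp \<Rightarrow> memory \<Rightarrow> int" where
  "aval (Const i) s = i"
| "aval (Load x a) s = s x (aval a s)"
| "aval (Add a b) s = aval a s + aval b s"
| "aval (Sub a b) s = aval a s - aval b s"

primrec bval :: "bexp \<Rightarrow> memory \<Rightarrow> bool" where
  "bval (Less a b) s \<longleftrightarrow> aval a s < aval b s"
| "bval (Neg b) s \<longleftrightarrow> \<not> bval b s"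
| "bval (Conj b c) s \<longleftrightarrow> bval b s \<and> bval c s"

text \<open>\<open>exec c s t s'\<close>: started in memory \<open>s\<close>, program \<open>c\<close> halts after time \<open>t\<close> with memory \<open>s'\<close>.
  The command \<open>Store x a b\<close> is the assignment \<open>x[a] := b\<close>.\<close>

inductive exec :: "com \<Rightarrow> memory \<Rightarrow> nat \<Rightarrow> memory \<Rightarrow> bool" where
  Skip: "exec Skip s 1 s"
| Store: "exec (Store x a b) s 1 (s(x := (s x)(aval a s := aval b s)))"
| Seq: "exec c1 s t1 s1 \<Longrightarrow> exec c2 s1 t2 s2 \<Longrightarrow> exec (Seq c1 c2) s (t1 + t2) s2"
| CondTrue: "bval b s \<Longrightarrow> exec c1 s t s' \<Longrightarrow> exec (Cond b c1 c2) s (t + 1) s'"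
| CondFalse: "\<not> bval b s \<Longrightarrow> exec c2 s t s' \<Longrightarrow> exec (Cond b c1 c2) s (t + 1) s'"
| WhileFalse: "\<not> bval b s \<Longrightarrow> exec (While b c) s 1 s"
| WhileTrue: "bval b s \<Longrightarrow> exec c s t1 s1 \<Longrightarrow> exec (While b c) s1 t2 s2 \<Longrightarrow>
    exec (While b c) s (t1 + t2 + 1) s2"

inductive_cases exec_SkipE: "exec Skip s t s'"
inductive_cases exec_StoreE: "exec (Store x a b) s t s'"
inductive_cases exec_SeqE: "exec (Seq c1 c2) s t s'"
inductive_cases exec_CondE: "exec (Cond b c1 c2) s t s'"
inductive_cases exec_WhileE: "exec (While b c) s t s'"

lemma exec_deterministic: "exec c s t s' \<Longrightarrow> exec c s u s'' \<Longrightarrow> u = t \<and> s'' = s'"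
proof (induction arbitrary: u s'' rule: exec.induct)
  case Skip
  then show ?case by (elim exec_SkipE) simp
next
  case Store
  then show ?case by (elim exec_StoreE) simp
next
  case (Seq c1 s t1 s1 c2 t2 s2)
  from Seq.prems obtain u1 m u2 where "exec c1 s u1 m" "exec c2 m u2 s''" "u = u1 + u2"
    by (elim exec_SeqE)
  with Seq.IH show ?case by metis
next
  case (CondTrue b s c1 t s' c2)
  from CondTrue.prems CondTrue.hyps obtain u' where "exec c1 s u' s''" "u = u' + 1"
    by (elim exec_CondE) simp_all
  with CondTrue.IH show ?case by metis
next
  case (CondFalse b s c2 t s' c1)
  from CondFalse.prems CondFalse.hyps obtain u' where "exec c2 s u' s''" "u = u' + 1"
    by (elim exec_CondE) simp_all
  with CondFalse.IH show ?case by metis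
next
  case (WhileFalse b s c)
  from WhileFalse.prems show ?case
    by (rule exec_WhileE) (use WhileFalse.hyps in simp_all)
next
  case (WhileTrue b s c t1 s1 t2 s2)
  from WhileTrue.prems obtain u1 m u2
    where "exec c s u1 m" "exec (While b c) m u2 s''" "u = u1 + u2 + 1"
    by (rule exec_WhileE) (use WhileTrue.hyps(1) in simp_all)
  with WhileTrue.IH show ?case by metis
qed

text \<open>The set \<open>W\<close> is supplied as its increasing list of elements together with its cardinality.\<close>

definition input_memory :: "nat \<Rightarrow> nat \<Rightarrow> int set \<Rightarrow> memory" where
  "input_memory n k W = (\<lambda>x i.
     if x = ''n'' \<and> i = 0 then int n
     else if x = ''k'' \<and> i = 0 then int k
     else if x = ''size'' \<and> i = 0 then int (card W)
     else if x = ''W'' \<and> 0 \<le> i \<and> i < int (card W) then sorted_list_of_set W ! nat i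
     else 0)"

text \<open>The result is read off as a list of its elements, in any order and possibly with
  repetitions, stored at the addresses from 0 up to the length given in a second array.\<close>

definition output_set :: "memory \<Rightarrow> int set" where
  "output_set s = s ''out'' ` {0..<s ''outsize'' 0}"

definition outputs :: "com \<Rightarrow> memory \<Rightarrow> int set \<Rightarrow> bool" where
  "outputs c s X \<longleftrightarrow> (\<exists>t s'. exec c s t s' \<and> output_set s' = X)"

definition halts_within :: "com \<Rightarrow> memory \<Rightarrow> nat \<Rightarrow> bool" where
  "halts_within c s b \<longleftrightarrow> (\<exists>t s'. exec c s t s' \<and> t \<le> b)"

definition uniquely_recoverable :: "int set \<Rightarrow> bool" where
  "uniquely_recoverable V \<longleftrightarrow> (\<forall>U. dist_set U = dist_set V \<longrightarrow> shift_reflect V U)"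

text \<open>Meaningful only for \<open>k \<le> n\<close>, since otherwise there are no subsets to choose from.\<close>

definition random_subset :: "nat \<Rightarrow> nat \<Rightarrow> int set pmf" where
  "random_subset n k = pmf_of_set {V. V \<subseteq> {0..<int n} \<and> card V = k}"

end

theory Submission
  imports Defs
begin

text \<open>
  Let \<open>V\<close> have minimum \<open>0\<close> and maximum \<open>M\<close>, and let \<open>W\<close> be its distance set. The algorithm grows a
  set \<open>T\<close>, starting from \<open>{0, M}\<close>, by trying \<open>1, M - 1, 2, M - 2, \<dots>\<close> in turn and keeping a candidate if
  all its distances to \<open>T\<close> lie in \<open>W\<close>. Near the two ends of \<open>V\<close> there are so few elements that they
  satisfy no additive relation of bounded length, whereas a distance lies in \<open>W\<close> by accident only with
  probability about \<open>k\<^sup>2 / n\<close>, which is at most \<open>n\<close> to the power \<open>- 2 \<epsilon>\<close>. Hence \<open>T\<close> first acquires exactly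
  the elements of \<open>V\<close> near the ends (up to reflection), and as soon as these are more than a certain
  constant multiple of \<open>1 / \<epsilon>\<^sup>2\<close>, with high probability no \<open>x\<close> outside \<open>V\<close> has all its distances to
  them in \<open>W\<close>. The same two facts give uniqueness: a set \<open>U\<close> with distance set \<open>W\<close> contains the end
  elements of \<open>V\<close> up to reflection, because those correspond to the elements of \<open>M - W\<close> that are not
  sums of two nonzero elements of \<open>M - W\<close>.

  Random subsets are replaced by random functions. All probability bounds count functions \<open>f\<close> for
  which some value \<open>f y\<close> is restricted to few possibilities by the other values of \<open>f\<close>.
\<close>

section \<open>Sets without additive relations near their ends\<close>

text \<open>The obstacle is dependence. For a point \<open>x\<close>, the representations
  \<open>x = e + p - q\<close> belonging to different end elements \<open>e\<close> may share
  \<open>p\<close> and \<open>q\<close>, so their probabilities do not simply multiply. A chain of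
  \<open>l\<close> links, each with a fresh element, restores a bound of order
  \<open>(Q k^2 / n)^l\<close>. The union bound over \<open>n\<close> points \<open>x\<close> is
  then met by \<open>l\<close> at least \<open>1 / \<epsilon>\<close>, and finding \<open>l\<close>
  fresh elements takes about \<open>9 l^2\<close> end elements: this is the origin of the constant.
  A second difficulty is that the ends of \<open>V\<close> depend on \<open>V\<close>, while
  counting needs a set fixed in advance. So the end elements are enclosed in a fixed window
  \<open>S\<close> that receives at most \<open>Q\<close> values, with \<open>Q\<close> about
  \<open>n\<close> to the power \<open>\<epsilon> / 4\<close>. A short window with enough elements
  exists only if \<open>k\<close> is not too small. Below a constant multiple of \<open>n\<close> to
  the power \<open>\<epsilon> / 8\<close>, the window is the whole range and every element of
  \<open>V\<close> counts as an end element.\<close>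

lemma abs_mem_dist_set: "\<bar>y\<bar> \<in> dist_set V \<longleftrightarrow> (\<exists>p\<in>V. \<exists>q\<in>V. y = p - q)"
  unfolding dist_set_def by (auto simp: abs_if) (smt (verit))+

lemma dist_set_image:
  assumes "\<And>a b. \<bar>f a - f b\<bar> = \<bar>a - b\<bar>"
  shows "dist_set (f ` V) = dist_set V"
proof -
  have "dist_set U = (\<lambda>(a, b). \<bar>a - b\<bar>) ` (U \<times> U)" for U
    unfolding dist_set_def by auto
  moreover have "(\<lambda>(a, b). \<bar>a - b\<bar>) ` (f ` V \<times> f ` V) = (\<lambda>(a, b). \<bar>f a - f b\<bar>) ` (V \<times> V)"
    by force
  ultimately show ?thesis by (simp add: assms)
qed

lemma dist_set_shift [simp]: "dist_set ((\<lambda>v. c + v) ` V) = dist_set V"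
  by (rule dist_set_image) simp

lemma dist_set_reflect [simp]: "dist_set ((\<lambda>v. c - v) ` V) = dist_set V"
  by (rule dist_set_image) simp

section \<open>Greedy scan and generic sets\<close>

definition compatible :: "int set \<Rightarrow> int set \<Rightarrow> int \<Rightarrow> bool" where
  "compatible W T x \<longleftrightarrow> (\<forall>t\<in>T. \<bar>x - t\<bar> \<in> W)"

definition extend :: "int set \<Rightarrow> int \<Rightarrow> int set \<Rightarrow> int set" where
  "extend W x T = (if compatible W T x then insert x T else T)"

text \<open>The two candidates at depth \<open>Suc d\<close> are tested one after the other, so the
  right one must also agree with the left one if that was kept. This order breaks the tie between a
  set and its reflection. When the scan reaches depth \<open>M - 1\<close>, every candidate has come
  up twice, once from each end.\<close>

primrec greedy :: "int set \<Rightarrow> int \<Rightarrow> nat \<Rightarrow> int set" where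
  "greedy W M 0 = {0, M}"
| "greedy W M (Suc d) = extend W (M - int (Suc d)) (extend W (int (Suc d)) (greedy W M d))"

text \<open>
  \<open>E\<close> consists of the elements near the two ends. For small \<open>V\<close> one can choose \<open>r > M\<close>, so that
  \<open>E = V\<close> and \<open>separated\<close> is not needed.
\<close>

locale generic_set =
  fixes V :: "int set" and M r :: int
  assumes zero_mem: "0 \<in> V" and max_mem: "M \<in> V" and bounds: "V \<subseteq> {0..M}"
    and M_pos: "0 < M" and r_pos: "0 < r"
  fixes E defines "E \<equiv> {v \<in> V. v < r \<or> M - v < r}"
  assumes four: "\<And>e1 e2 e3 e4 e5 e6 e7 e8. {e1, e2, e3, e4, e5, e6, e7, e8} \<subseteq> E \<Longrightarrow>
      e1 + e2 + e3 + e4 = e5 + e6 + e7 + e8 \<Longrightarrow> {#e1, e2, e3, e4#} = {#e5, e6, e7, e8#}"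
    and two: "\<And>e1 e2 e3 e4 p q. {e1, e2, e3, e4} \<subseteq> E \<Longrightarrow> p \<in> V \<Longrightarrow> q \<in> V \<Longrightarrow>
      e1 + e2 + p = e3 + e4 + q \<Longrightarrow> {e1, e2} \<inter> {e3, e4} \<noteq> {}"
    and separated: "M < r \<or> (\<forall>x\<in>{0..M}. \<exists>e\<in>E - {x}. \<forall>p\<in>V - {x}. \<forall>q\<in>V - {x}. x \<noteq> e + p - q)"
begin

lemma E_iff: "e \<in> E \<longleftrightarrow> e \<in> V \<and> (e < r \<or> M - e < r)"
  by (auto simp: E_def)

lemma zero_E: "0 \<in> E" and M_E: "M \<in> E"
  using zero_mem max_mem r_pos by (auto simp: E_iff)

text \<open>By this symmetry, arguments about the scan may assume that the first interior element is
  met at the left end.\<close>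

lemma reflect: "generic_set ((\<lambda>v. M - v) ` V) M r"
proof -
  have mem: "v \<in> (\<lambda>v. M - v) ` V \<longleftrightarrow> M - v \<in> V" for v
    by (metis (no_types, lifting) diff_diff_eq2 add_diff_cancel_left' image_iff)
  have memE: "v \<in> {v \<in> (\<lambda>v. M - v) ` V. v < r \<or> M - v < r} \<longleftrightarrow> M - v \<in> E" for v
    by (auto simp: mem E_iff)
  show ?thesis
  proof (unfold_locales, goal_cases)
    case (6 e1 e2 e3 e4 e5 e6 e7 e8)
    then have "{M - e1, M - e2, M - e3, M - e4, M - e5, M - e6, M - e7, M - e8} \<subseteq> E"
      by (simp only: insert_subset memE) simp
    moreover have "(M - e1) + (M - e2) + (M - e3) + (M - e4)
        = (M - e5) + (M - e6) + (M - e7) + (M - e8)"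
      using 6(2) by simp
    ultimately have "{#M - e1, M - e2, M - e3, M - e4#} = {#M - e5, M - e6, M - e7, M - e8#}"
      by (rule four)
    then have "image_mset (\<lambda>v. M - v) {#M - e1, M - e2, M - e3, M - e4#}
       = image_mset (\<lambda>v. M - v) {#M - e5, M - e6, M - e7, M - e8#}" by (rule arg_cong)
    then show ?case by simp
  next
    case (7 e1 e2 e3 e4 p q)
    have "{M - e1, M - e2, M - e3, M - e4} \<subseteq> E"
      using 7(1) by (simp only: insert_subset memE) simp
    moreover have "M - p \<in> V" "M - q \<in> V" using 7(2,3) by (simp_all add: mem)
    moreover have "(M - e1) + (M - e2) + (M - p) = (M - e3) + (M - e4) + (M - q)" using 7(4) by simp
    ultimately have "{M - e1, M - e2} \<inter> {M - e3, M - e4} \<noteq> {}" by (rule two)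
    then show ?case by auto
  next
    case 8
    show ?case
    proof (cases "M < r")
      case False
      show ?thesis
      proof (intro disjI2 ballI)
        fix x assume "x \<in> {0..M}"
        then have "M - x \<in> {0..M}" by simp
        with separated False obtain e where e: "e \<in> E - {M - x}"
            "\<forall>p\<in>V - {M - x}. \<forall>q\<in>V - {M - x}. M - x \<noteq> e + p - q" by blast
        have "M - e \<in> {v \<in> (\<lambda>v. M - v) ` V. v < r \<or> M - v < r} - {x}"
          using e(1) memE[of "M - e"] by auto
        moreover have "\<forall>p\<in>(\<lambda>v. M - v) ` V - {x}. \<forall>q\<in>(\<lambda>v. M - v) ` V - {x}. x \<noteq> M - e + p - q"
        proof (intro ballI notI)
          fix p q assume *: "p \<in> (\<lambda>v. M - v) ` V - {x}" "q \<in> (\<lambda>v. M - v) ` V - {x}" "x = M - e + p - q"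
          then have "M - p \<in> V - {M - x}" "M - q \<in> V - {M - x}" by auto
          with e(2) have "M - x \<noteq> e + (M - p) - (M - q)" by blast
          with *(3) show False by auto
        qed
        ultimately show "\<exists>e\<in>{v \<in> (\<lambda>v. M - v) ` V. v < r \<or> M - v < r} - {x}.
           \<forall>p\<in>(\<lambda>v. M - v) ` V - {x}. \<forall>q\<in>(\<lambda>v. M - v) ` V - {x}. x \<noteq> e + p - q" by blast
      qed
    qed simp
  qed (use zero_mem max_mem bounds M_pos r_pos in \<open>auto simp: mem\<close>)
qed

section \<open>Uniqueness from the end elements\<close>

text \<open>A representation \<open>M - e - e' = p - q\<close> would be the relation
  \<open>e + e' + p = 0 + M + q\<close>, which \<open>two\<close> excludes. As \<open>M - e'\<close>
  is the mirror image of \<open>e'\<close>, no set with all distances in \<open>W\<close> contains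
  both \<open>e\<close> and the mirror image of \<open>e'\<close>. This rules out hybrids of
  \<open>V\<close> and its reflection; \<open>e = e'\<close> is allowed.\<close>

lemma not_ambiguous:
  assumes "e \<in> E - {0, M}" "e' \<in> E - {0, M}"
  shows "\<bar>M - e - e'\<bar> \<notin> dist_set V"
proof
  assume "\<bar>M - e - e'\<bar> \<in> dist_set V"
  then obtain p q where "p \<in> V" "q \<in> V" "e + e' + p = 0 + M + q"
    unfolding abs_mem_dist_set by force
  from two[OF _ this] assms zero_E M_E show False by auto
qed

text \<open>For \<open>r \<le> M\<close> this is \<open>separated\<close>. For \<open>M < r\<close>
  all of \<open>V\<close> is free of four-term relations, and the distances from \<open>x\<close> to
  \<open>0\<close> and \<open>M\<close> leave, besides members of \<open>V\<close>, only a mirror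
  image of an element of \<open>V\<close>, which \<open>not_ambiguous\<close> rejects.\<close>

lemma compatible_mem:
  assumes x: "x \<in> {0..M}" and c: "compatible (dist_set V) E x"
  shows "x \<in> V"
proof (rule ccontr)
  assume nx: "x \<notin> V"
  show False
  proof (cases "M < r")
    case False
    then obtain e where e: "e \<in> E" "\<forall>p\<in>V - {x}. \<forall>q\<in>V - {x}. x \<noteq> e + p - q"
      using separated x by blast
    then obtain p q where "p \<in> V" "q \<in> V" "x - e = p - q"
      using c unfolding compatible_def abs_mem_dist_set by blast
    moreover have "p \<in> V - {x}" "q \<in> V - {x}" using nx calculation by auto
    ultimately show False using e(2) by force
  next
    case True
    then have EV: "E = V" using bounds by (auto simp: E_iff)
    obtain v1 w1 where vw1: "v1 \<in> V" "w1 \<in> V" "x - 0 = v1 - w1"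
      using c zero_E unfolding compatible_def abs_mem_dist_set by blast
    obtain w2 v2 where vw2: "w2 \<in> V" "v2 \<in> V" "x - M = w2 - v2"
      using c M_E unfolding compatible_def abs_mem_dist_set by blast
    \<comment> \<open>Equating the two expressions for \<open>x\<close> gives
      \<open>M + w1 + w2 = v1 + v2\<close>; zeros pad both sides to four terms.\<close>
    have "{#M, w1, w2, 0#} = {#0, v1, v2, 0#}"
      by (rule four) (use vw1 vw2 EV zero_mem max_mem in auto)
    then have eq: "{#M, w1, w2#} = {#0, v1, v2#}" by (simp add: add_mset_commute)
    have "0 \<in># {#M, w1, w2#}" unfolding eq by simp
    with M_pos consider "w1 = 0" | "w2 = 0" by auto
    then show False
    proof cases
      case 1
      with vw1 nx show False by simp
    next
      case 2
      have "count {#M, w1, w2#} v1 = count {#0, v1, v2#} v1" by (simp only: eq)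
      then consider "v1 = 0" | "v1 = w1" | "v1 = M" using \<open>w2 = 0\<close> by (auto split: if_splits)
      then show False
      proof cases
        case 1
        have "0 \<le> w1" using vw1(2) bounds by auto
        then show False using vw1(3) 1 x zero_mem nx by auto
      next
        case 2
        with vw1(3) zero_mem nx show False by simp
      next
        case 3
        \<comment> \<open>Here \<open>x = M - w1\<close> is the mirror image of \<open>w1\<close>,
          and it clashes with \<open>w1\<close> itself.\<close>
        have w1: "w1 \<in> E" using vw1 EV by simp
        have "w1 \<noteq> 0" "w1 \<noteq> M" using vw1(3) 3 nx zero_mem max_mem by auto
        then have "\<bar>M - w1 - w1\<bar> \<notin> dist_set V" using not_ambiguous[of w1 w1] w1 by auto
        moreover have "\<bar>x - w1\<bar> \<in> dist_set V" using c w1 unfolding compatible_def by blast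
        ultimately show False using vw1(3) 3 by simp
      qed
    qed
  qed
qed

text \<open>The second inclusion is the reason why \<open>separated\<close> also speaks of points of
  \<open>V\<close>: if \<open>v\<close> were missing from \<open>U\<close>, the distances from
  \<open>v\<close> to \<open>E\<close> would have to be realized by pairs in \<open>U\<close>, hence
  by pairs in \<open>V\<close> avoiding \<open>v\<close>.\<close>

lemma subset_E_imp_eq:
  assumes U: "U \<subseteq> {0..M}" "dist_set U = dist_set V" "E \<subseteq> U"
  shows "U = V"
proof
  show UV: "U \<subseteq> V"
  proof
    fix u assume "u \<in> U"
    moreover have "compatible (dist_set V) E u"
      unfolding compatible_def U(2)[symmetric] abs_mem_dist_set using \<open>u \<in> U\<close> U(3) by blast
    ultimately show "u \<in> V" using compatible_mem U(1) by blast
  qed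
  show "V \<subseteq> U"
  proof (rule ccontr)
    assume "\<not> V \<subseteq> U"
    then obtain v where v: "v \<in> V" "v \<notin> U" by blast
    then have "\<not> M < r" using U(3) bounds by (force simp: E_iff)
    moreover have "v \<in> {0..M}" using v bounds by blast
    ultimately obtain e where e: "e \<in> E" "\<forall>p\<in>V - {v}. \<forall>q\<in>V - {v}. v \<noteq> e + p - q"
      using separated by blast
    have "\<bar>v - e\<bar> \<in> dist_set V" using v e(1) unfolding abs_mem_dist_set E_iff by blast
    then obtain p q where "p \<in> U" "q \<in> U" "v - e = p - q"
      unfolding U(2)[symmetric] abs_mem_dist_set by blast
    moreover have "p \<in> V - {v}" "q \<in> V - {v}" using calculation UV v by auto
    ultimately show False using e(2) by force
  qed
qed

text \<open>The elements of \<open>M - W\<close> below \<open>r\<close> that are not sums of two nonzero elements of \<open>M - W\<close>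
  come from single elements of \<open>V\<close> near the two ends.\<close>

lemma mem_or_reflect_mem:
  assumes U: "U \<subseteq> {0..M}" "0 \<in> U" "M \<in> U" "dist_set U = dist_set V" and e: "e \<in> E"
  shows "e \<in> U \<or> M - e \<in> U"
proof (cases "e = 0 \<or> e = M")
  case False
  have eV: "e \<in> V" using e by (simp add: E_iff)
  then have e0: "0 < e" "e < M" using False bounds by force+
  define a where "a = (if e < r then e else M - e)"
  have a: "a < r" "0 < a" "a < M" "a = e \<or> a = M - e" using e e0 unfolding a_def E_iff by auto
  have "\<bar>M - a\<bar> \<in> dist_set V"
    using a(4) eV zero_mem max_mem unfolding abs_mem_dist_set by (metis diff_diff_eq2 add_diff_cancel_left' diff_zero)
  then obtain u' u where u: "u' \<in> U" "u \<in> U" "M - a = u' - u"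
    unfolding U(4)[symmetric] abs_mem_dist_set by blast
  \<comment> \<open>In \<open>d = v + (M - w)\<close> both summands are nonnegative, so both are at
    most \<open>d\<close>, which is below \<open>r\<close>; this puts \<open>v\<close> and
    \<open>w\<close> into \<open>E\<close>.\<close>
  have split: "\<exists>v w. v \<in> E \<and> w \<in> E \<and> d = v + (M - w)" if d: "\<bar>M - d\<bar> \<in> dist_set V" "d \<le> a" for d
  proof -
    obtain w v where vw: "w \<in> V" "v \<in> V" "M - d = w - v"
      using d unfolding abs_mem_dist_set by blast
    moreover have "0 \<le> v" "w \<le> M" using vw bounds by auto
    ultimately have "v \<in> E" "w \<in> E" using a(1) d(2) unfolding E_iff by auto
    then show ?thesis using vw(3) by (intro exI[of _ v] exI[of _ w]) auto
  qed
  have ub: "0 \<le> u" "u' \<le> M" using u U(1) by auto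
  have "\<bar>M - u\<bar> \<in> dist_set V" unfolding U(4)[symmetric] abs_mem_dist_set using u U by blast
  then obtain v1 w1 where 1: "v1 \<in> E" "w1 \<in> E" "u = v1 + (M - w1)"
    using split[of u] u ub by auto
  have "\<bar>M - (M - u')\<bar> \<in> dist_set V"
    unfolding U(4)[symmetric] abs_mem_dist_set using u U by force
  then obtain v2 w2 where 2: "v2 \<in> E" "w2 \<in> E" "M - u' = v2 + (M - w2)"
    using split[of "M - u'"] u ub by auto
  \<comment> \<open>Irreducibility of \<open>a\<close>: splitting \<open>u\<close> and
    \<open>M - u'\<close> once more writes \<open>a\<close> as
    \<open>v1 + (M - w1) + v2 + (M - w2)\<close>, and \<open>four\<close> then forces one of the two
    parts \<open>u\<close>, \<open>M - u'\<close> to vanish.\<close>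
  have "u = 0 \<or> u' = M"
  proof (cases "a = e")
    case True
    have "{#e, 0, w1, w2#} = {#M, M, v1, v2#}"
      by (rule four) (use 1 2 u(3) True e zero_E M_E in auto)
    then have "count {#e, 0, w1, w2#} z = count {#M, M, v1, v2#} z" for z by simp
    from this[of 0] this[of M] e0 show ?thesis using 1 2 by (auto split: if_splits)
  next
    case False
    then have [simp]: "a = M - e" using a by simp
    have "{#w1, w2, 0, 0#} = {#e, M, v1, v2#}"
      by (rule four) (use 1 2 u(3) e zero_E M_E in auto)
    then have "count {#w1, w2, 0, 0#} z = count {#e, M, v1, v2#} z" for z by simp
    from this[of 0] this[of M] e0 show ?thesis using 1 2 by (auto split: if_splits)
  qed
  then show ?thesis using u a(4) by (auto simp: algebra_simps)
qed (use U in auto)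

text \<open>All end elements have the same orientation in \<open>U\<close>: if \<open>e\<close> is
  missing, then \<open>M - e\<close> is present, and an interior \<open>e'\<close> in
  \<open>U\<close> would create the forbidden distance \<open>\<bar>M - e - e'\<bar>\<close>. So
  \<open>U\<close> or its reflection contains all of \<open>E\<close>.\<close>

lemma unique:
  assumes U: "U \<subseteq> {0..M}" "0 \<in> U" "M \<in> U" "dist_set U = dist_set V"
  shows "U = V \<or> U = (\<lambda>v. M - v) ` V"
proof (cases "E \<subseteq> U")
  case True
  then show ?thesis using subset_E_imp_eq U by blast
next
  case False
  then obtain e where e: "e \<in> E" "e \<notin> U" by blast
  have Me: "M - e \<in> U" using mem_or_reflect_mem U e by blast
  let ?R = "\<lambda>v. M - v"
  have "E \<subseteq> ?R ` U"
  proof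
    fix e' assume e': "e' \<in> E"
    have "M - e' \<in> U"
    proof (rule ccontr)
      assume c: "M - e' \<notin> U"
      then have "e' \<in> U" using mem_or_reflect_mem U e' by blast
      then have "\<bar>M - e - e'\<bar> \<in> dist_set V"
        unfolding U(4)[symmetric] abs_mem_dist_set using Me by blast
      moreover have "e \<noteq> 0" "e \<noteq> M" "e' \<noteq> 0" "e' \<noteq> M" using e(2) c U by auto
      ultimately show False using not_ambiguous e e' by blast
    qed
    then show "e' \<in> ?R ` U" by (intro image_eqI[of _ _ "M - e'"]) auto
  qed
  moreover have "?R ` U \<subseteq> {0..M}" using U(1) by auto
  ultimately have "?R ` U = V" using subset_E_imp_eq[of "?R ` U"] U(4) by simp
  then have "?R ` V = U" by (auto simp: image_image)
  then show ?thesis by simp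
qed

section \<open>Correctness of the greedy scan\<close>

text \<open>Acceptance makes \<open>M - d\<close> a distance \<open>p - q\<close>. If
  \<open>q = 0\<close> or \<open>p = M\<close>, then \<open>V\<close> has an element at depth
  \<open>d\<close>, and the interior element \<open>e\<close>, already in \<open>T\<close>, rejects
  the candidate at the wrong end. Otherwise \<open>p\<close> and \<open>q\<close> are less deep than
  \<open>d\<close>, hence already in \<open>T\<close>, and testing \<open>x\<close> against one of
  them yields a relation excluded by \<open>two\<close>. From depth \<open>r\<close> on,
  \<open>T\<close> contains \<open>E\<close> and \<open>compatible_mem\<close> applies.\<close>

lemma extend_step:
  assumes T: "T \<subseteq> V" "0 \<in> T" "M \<in> T" and d: "0 < d" "d < M"
    and early: "\<And>v. v \<in> V \<Longrightarrow> v < d \<or> M - v < d \<Longrightarrow> v \<in> T"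
    and x: "x = d \<or> x = M - d" and c: "compatible (dist_set V) T x"
    and e: "e \<in> V - {0, M}" "e \<in> T" "e \<le> d \<or> M - e \<le> d"
  shows "x \<in> V"
proof (cases "r \<le> d")
  case True
  then have "E \<subseteq> T" using early by (fastforce simp: E_iff)
  then have "compatible (dist_set V) E x" using c unfolding compatible_def by blast
  then show ?thesis using compatible_mem x d by auto
next
  case False
  then have eE: "e \<in> E - {0, M}" using e by (auto simp: E_iff)
  have "\<bar>x - 0\<bar> \<in> dist_set V" "\<bar>x - M\<bar> \<in> dist_set V" using c T unfolding compatible_def by blast+
  then have "\<bar>M - d\<bar> \<in> dist_set V" using x d by auto
  then obtain p q where pq: "p \<in> V" "q \<in> V" "M - d = p - q" unfolding abs_mem_dist_set by blast
  have b: "0 \<le> q" "p \<le> M" using pq bounds by auto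
  have clash: "\<bar>x - t\<bar> \<in> dist_set V" if "t \<in> T" for t using c that unfolding compatible_def by blast
  consider "q = 0" | "p = M" | "0 < q" "p < M" using b by linarith
  then show ?thesis
  proof cases
    case 1
    then have "p \<in> E - {0, M}" using pq False d by (auto simp: E_iff)
    then have "\<bar>M - p - e\<bar> \<notin> dist_set V" using not_ambiguous eE by blast
    then have "x \<noteq> M - p" using clash[OF e(2)] by auto
    with x pq 1 show ?thesis by auto
  next
    case 2
    then have "q \<in> E - {0, M}" using pq False d by (auto simp: E_iff)
    then have "\<bar>M - q - e\<bar> \<notin> dist_set V" using not_ambiguous eE by blast
    then have "x \<noteq> M - q" using clash[OF e(2)] by auto
    with x pq 2 show ?thesis by auto
  next
    case 3
    then have "p \<in> T" "q \<in> T" using early pq by auto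
    moreover have E: "p \<in> E" "q \<in> E" using pq 3 False by (auto simp: E_iff)
    ultimately have "\<bar>x - p\<bar> \<in> dist_set V" "\<bar>x - q\<bar> \<in> dist_set V" using clash by auto
    then obtain s1 s2 s3 s4 where s: "s1 \<in> V" "s2 \<in> V" "s3 \<in> V" "s4 \<in> V"
        "x - p = s1 - s2" "x - q = s3 - s4" unfolding abs_mem_dist_set by blast
    from x show ?thesis
    proof
      \<comment> \<open>Substituting \<open>d = q + M - p\<close> into
        \<open>x - p = s1 - s2\<close> leaves a relation with only two terms possibly outside
        \<open>E\<close>. The mirrored case tests against \<open>q\<close> instead.\<close>
      assume "x = d"
      then have "q + M + s2 = p + p + s1" using s pq by auto
      from two[OF _ s(2,1) this] E M_E 3 pq d show ?thesis by auto
    next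
      assume "x = M - d"
      then have "p + 0 + s4 = q + q + s3" using s pq by auto
      from two[OF _ s(4,3) this] E zero_E 3 pq d show ?thesis by auto
    qed
  qed
qed

text \<open>While \<open>T\<close> is \<open>{0, M}\<close>, both orientations are still possible.
  The last clause records that an interior element has broken this symmetry.\<close>

definition tracks :: "int set \<Rightarrow> nat \<Rightarrow> bool" where
  "tracks T d \<longleftrightarrow> T \<subseteq> V \<and> (\<forall>v\<in>V. v \<le> int d \<or> M - v \<le> int d \<longrightarrow> v \<in> T) \<and>
     (\<exists>v\<in>V - {0, M}. v \<le> int d \<or> M - v \<le> int d)"

lemma compatible_V: "x \<in> V \<Longrightarrow> T \<subseteq> V \<Longrightarrow> compatible (dist_set V) T x"
  unfolding compatible_def abs_mem_dist_set by blast

text \<open>The alternative for \<open>e\<close> serves two stages: later on \<open>e\<close> is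
  already in \<open>T\<close>, whereas at the stage that breaks the symmetry \<open>e\<close> is the
  left candidate itself, accepted just before the right one is tested.\<close>

lemma tracks_extend:
  assumes T: "T \<subseteq> V" "0 \<in> T" "M \<in> T" and d: "int (Suc d) < M"
    and early: "\<And>v. v \<in> V \<Longrightarrow> v \<le> int d \<or> M - v \<le> int d \<Longrightarrow> v \<in> T"
    and e: "e \<in> V - {0, M}" "e = int (Suc d) \<or> e \<in> T" "e \<le> int (Suc d) \<or> M - e \<le> int (Suc d)"
  shows "tracks (extend (dist_set V) (M - int (Suc d)) (extend (dist_set V) (int (Suc d)) T)) (Suc d)"
proof -
  let ?W = "dist_set V" and ?d = "int (Suc d)"
  define T1 where "T1 = extend ?W ?d T"
  define T2 where "T2 = extend ?W (M - ?d) T1"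
  have TT: "T \<subseteq> T1" "T1 \<subseteq> T2" by (auto simp: T1_def T2_def extend_def)
  have early': "v \<in> T" if "v \<in> V" "v < ?d \<or> M - v < ?d" for v
    using early that by auto
  have T1: "T1 \<subseteq> V"
  proof (cases "compatible ?W T ?d")
    case True
    have "?d \<in> V"
    proof (cases "e = ?d")
      case False
      then have "e \<in> T" using e(2) by simp
      show ?thesis
        by (rule extend_step[OF T _ d early' _ True e(1) \<open>e \<in> T\<close> e(3)]) auto
    qed (use e in auto)
    then show ?thesis using T by (auto simp: T1_def extend_def)
  qed (use T in \<open>auto simp: T1_def extend_def\<close>)
  have d1: "?d \<in> T1" if "?d \<in> V" using compatible_V[OF that T(1)] by (auto simp: T1_def extend_def)
  have T2: "T2 \<subseteq> V"
  proof (cases "compatible ?W T1 (M - ?d)")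
    case True
    have "e \<in> T1" using e d1 TT by auto
    have "M - ?d \<in> V"
      by (rule extend_step[OF T1 _ _ _ d _ _ True e(1) \<open>e \<in> T1\<close> e(3)]) (use T(2,3) TT early' in auto)
    then show ?thesis using T1 by (auto simp: T2_def extend_def)
  qed (use T1 in \<open>auto simp: T2_def extend_def\<close>)
  have d2: "M - ?d \<in> T2" if "M - ?d \<in> V" using compatible_V[OF that T1] by (auto simp: T2_def extend_def)
  have "v \<in> T2" if v: "v \<in> V" "v \<le> ?d \<or> M - v \<le> ?d" for v
  proof -
    consider "v = ?d" | "v = M - ?d" | "v < ?d \<or> M - v < ?d" using v by linarith
    then show ?thesis by cases (use v d1 d2 early' TT in auto)
  qed
  then show ?thesis unfolding tracks_def T1_def[symmetric] T2_def[symmetric] using T2 e(1,3) by auto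
qed

lemma greedy_ends: "0 \<in> greedy W M d" "M \<in> greedy W M d"
  by (induction d) (auto simp: extend_def)

lemma greedy_tracks_mono:
  assumes "tracks (greedy (dist_set V) M d) d" "int d < M" "d \<le> d'" "int d' < M"
  shows "tracks (greedy (dist_set V) M d') d'"
  using assms(3,4)
proof (induction d' rule: dec_induct)
  case (step d')
  then have t: "tracks (greedy (dist_set V) M d') d'" by simp
  then obtain e where e: "e \<in> V - {0, M}" "e \<le> int d' \<or> M - e \<le> int d'"
    unfolding tracks_def by blast
  show ?case unfolding greedy.simps
  proof (rule tracks_extend[of _ _ e])
    show "e = int (Suc d') \<or> e \<in> greedy (dist_set V) M d'" using t e unfolding tracks_def by blast
    show "v \<in> greedy (dist_set V) M d'" if "v \<in> V" "v \<le> int d' \<or> M - v \<le> int d'" for v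
      using t that unfolding tracks_def by blast
    show "e \<le> int (Suc d') \<or> M - e \<le> int (Suc d')" using e(2) by linarith
  qed (use t e(1) step.prems greedy_ends in \<open>simp_all add: tracks_def\<close>)
qed (use assms in simp)

lemma tracks_final:
  assumes "tracks T d" "int (Suc d) = M" "M \<in> T"
  shows "T = V"
proof
  show "V \<subseteq> T"
  proof
    fix v assume v: "v \<in> V"
    then have "v \<le> int d \<or> v = M" using bounds assms(2) by force
    then show "v \<in> T" using v assms(1,3) unfolding tracks_def by blast
  qed
qed (use assms(1) in \<open>simp add: tracks_def\<close>)

text \<open>Either candidate at depth \<open>Suc d\<close> would require the distance
  \<open>M - int (Suc d)\<close>. A pair other than the two ends falls short of \<open>M\<close> by
  more than that depth, since any interior element is deeper.\<close>

lemma greedy_trivial: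
  assumes "\<And>v. v \<in> V - {0, M} \<Longrightarrow> int d < v \<and> v < M - int d" "int d < M"
  shows "greedy (dist_set V) M d = {0, M}"
  using assms
proof (induction d)
  case (Suc d)
  have "int d < v \<and> v < M - int d" if "v \<in> V - {0, M}" for v
    using Suc.prems(1)[OF that] by linarith
  then have T: "greedy (dist_set V) M d = {0, M}" by (rule Suc.IH) (use Suc.prems(2) in linarith)+
  have "\<not> compatible (dist_set V) {0, M} x" if x: "x = int (Suc d) \<or> x = M - int (Suc d)" for x
  proof
    assume "compatible (dist_set V) {0, M} x"
    then have "\<bar>x\<bar> \<in> dist_set V" "\<bar>x - M\<bar> \<in> dist_set V" unfolding compatible_def by auto
    moreover have "x = M - int (Suc d) \<or> x - M = - (M - int (Suc d))" using x by linarith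
    ultimately have "\<bar>M - int (Suc d)\<bar> \<in> dist_set V" by (elim disjE) (simp_all only: abs_minus_cancel)
    then obtain p q where pq: "p \<in> V" "q \<in> V" "M - int (Suc d) = p - q" unfolding abs_mem_dist_set by blast
    have "0 \<le> q" "p \<le> M" "0 \<le> p" "q \<le> M" using pq bounds by auto
    moreover have "p = 0 \<or> p = M \<or> p < M - int (Suc d)" "q = 0 \<or> q = M \<or> int (Suc d) < q"
      using Suc.prems(1)[of p] Suc.prems(1)[of q] pq(1,2) by blast+
    ultimately show False using pq(3) Suc.prems(2) by linarith
  qed
  then show ?case by (simp add: T extend_def)
qed simp

lemma greedy_first:
  assumes v: "int (Suc d) \<in> V" "int (Suc d) < M"
    and first: "\<And>v. v \<in> V - {0, M} \<Longrightarrow> int d < v \<and> v < M - int d"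
  shows "greedy (dist_set V) M (nat M - 1) = V"
proof -
  have T: "greedy (dist_set V) M d = {0, M}" using greedy_trivial first v(2) by simp
  have "tracks (greedy (dist_set V) M (Suc d)) (Suc d)" unfolding greedy.simps T
  proof (rule tracks_extend[of _ _ "int (Suc d)"])
    fix w assume "w \<in> V" "w \<le> int d \<or> M - w \<le> int d"
    then have "w \<notin> V - {0, M}" using first[of w] by linarith
    then show "w \<in> {0, M}" using \<open>w \<in> V\<close> by blast
  qed (use v zero_mem max_mem in auto)
  then have "tracks (greedy (dist_set V) M (nat M - 1)) (nat M - 1)"
    by (rule greedy_tracks_mono) (use v in auto)
  then show ?thesis by (rule tracks_final) (use M_pos greedy_ends in auto)
qed

text \<open>The least depth of an interior element decides the orientation. If that element is at
  the right end, the reflected set has one at the left end and the same distance set, so the scan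
  builds the reflection.\<close>

lemma greedy_correct:
  "greedy (dist_set V) M (nat M - 1) = V \<or> greedy (dist_set V) M (nat M - 1) = (\<lambda>v. M - v) ` V"
proof (cases "V - {0, M} = {}")
  case True
  then have "greedy (dist_set V) M (nat M - 1) = {0, M}" by (intro greedy_trivial) (use M_pos in auto)
  also have "\<dots> = V" using True zero_mem max_mem by auto
  finally show ?thesis by simp
next
  case False
  define P where "P \<equiv> \<lambda>d. \<exists>v\<in>V - {0, M}. v = int (Suc d) \<or> M - v = int (Suc d)"
  from False obtain v where v: "v \<in> V - {0, M}" by blast
  then have "v \<in> {0..M}" using bounds by blast
  then have "0 < v" using v by simp
  then have "P (nat v - 1)" unfolding P_def using v by (intro bexI[of _ v]) auto
  then have P: "P (LEAST d. P d)" by (rule LeastI)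
  define d where "d = (LEAST d. P d)"
  have first: "int d < v \<and> v < M - int d" if v: "v \<in> V - {0, M}" for v
  proof -
    have "v \<in> {0..M}" using v bounds by blast
    then have "0 < v" "v < M" using v by auto
    then have "P (nat v - 1)" "P (nat (M - v) - 1)"
      unfolding P_def using v by (auto intro!: bexI[of _ v])
    then have "d \<le> nat v - 1" "d \<le> nat (M - v) - 1" unfolding d_def by (auto intro: Least_le)
    then show ?thesis using \<open>0 < v\<close> \<open>v < M\<close> by linarith
  qed
  obtain v where v: "v \<in> V - {0, M}" "v = int (Suc d) \<or> M - v = int (Suc d)"
    using P unfolding d_def[symmetric] unfolding P_def by blast
  have "v \<in> {0..M}" using v bounds by blast
  then have vM: "0 < v" "v < M" using v by auto
  from v(2) show ?thesis
  proof
    assume "v = int (Suc d)"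
    then show ?thesis using greedy_first[OF _ _ first] v vM by auto
  next
    assume *: "M - v = int (Suc d)"
    interpret R: generic_set "(\<lambda>v. M - v) ` V" M r "{v \<in> (\<lambda>v. M - v) ` V. v < r \<or> M - v < r}"
      by (rule reflect)
    have "greedy (dist_set ((\<lambda>v. M - v) ` V)) M (nat M - 1) = (\<lambda>v. M - v) ` V"
    proof (rule R.greedy_first)
      show "int (Suc d) \<in> (\<lambda>v. M - v) ` V" unfolding *[symmetric] using v by blast
      show "int (Suc d) < M" using * vM by linarith
      fix w assume "w \<in> (\<lambda>v. M - v) ` V - {0, M}"
      then show "int d < w \<and> w < M - int d" using first[of "M - w"] by auto
    qed
    then show ?thesis by simp
  qed
qed

end

section \<open>The program and its running time\<close>

text \<open>Asking for one execution is enough, since \<open>exec\<close> is deterministic.\<close>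

definition runs :: "com \<Rightarrow> memory \<Rightarrow> nat \<Rightarrow> (memory \<Rightarrow> bool) \<Rightarrow> bool" where
  "runs c s b Q \<longleftrightarrow> (\<exists>t s'. exec c s t s' \<and> t \<le> b \<and> Q s')"

lemma runs_Skip: "Q s \<Longrightarrow> 1 \<le> b \<Longrightarrow> runs Skip s b Q"
  unfolding runs_def using exec.Skip by blast

lemma runs_Store:
  "Q (s(x := (s x)(aval i s := aval a s))) \<Longrightarrow> 1 \<le> b \<Longrightarrow> runs (Store x i a) s b Q"
  unfolding runs_def using exec.Store by blast

lemma runs_mono: "runs c s b P \<Longrightarrow> b \<le> b' \<Longrightarrow> (\<And>s'. P s' \<Longrightarrow> Q s') \<Longrightarrow> runs c s b' Q"
  unfolding runs_def by (meson le_trans)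

lemma runs_Seq:
  assumes "runs c1 s b1 P" "\<And>s'. P s' \<Longrightarrow> runs c2 s' b2 Q" "b1 + b2 \<le> b"
  shows "runs (Seq c1 c2) s b Q"
  using assms unfolding runs_def by (meson exec.Seq add_mono le_trans)

lemma runs_Store_Seq:
  assumes "runs c (s(x := (s x)(aval i s := aval a s))) b Q" "b + 1 \<le> b'"
  shows "runs (Seq (Store x i a) c) s b' Q"
  by (rule runs_Seq[where P = "\<lambda>s'. s' = s(x := (s x)(aval i s := aval a s))" and ?b1.0 = 1 and ?b2.0 = b])
    (use assms in \<open>auto intro: runs_Store\<close>)

lemma runs_Cond:
  assumes "bval b s \<Longrightarrow> runs c1 s m Q" "\<not> bval b s \<Longrightarrow> runs c2 s m Q" "m + 1 \<le> m'"
  shows "runs (Cond b c1 c2) s m' Q"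
proof (cases "bval b s")
  case True
  with assms(1) show ?thesis using assms(3) exec.CondTrue[OF True] unfolding runs_def
    by (meson add_le_mono1 le_trans)
next
  case False
  with assms(2) show ?thesis using assms(3) exec.CondFalse[OF False] unfolding runs_def
    by (meson add_le_mono1 le_trans)
qed

text \<open>The invariant is indexed by the number of completed iterations. Each iteration pays one
  extra unit for its test, and the final unit pays for the test that fails.\<close>

lemma runs_While:
  assumes step: "\<And>j s. j < N \<Longrightarrow> I j s \<Longrightarrow> bval b s \<and> runs c s m (I (Suc j))"
    and stop: "\<And>s. I N s \<Longrightarrow> \<not> bval b s" and init: "I 0 s" and m': "N * (m + 1) + 1 \<le> m'"
  shows "runs (While b c) s m' (I N)"
proof -
  have "runs (While b c) s (i * (m + 1) + 1) (I N)" if "I (N - i) s" "i \<le> N" for i s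
    using that
  proof (induction i arbitrary: s)
    case 0
    then show ?case using exec.WhileFalse stop unfolding runs_def by (metis add.left_neutral diff_zero le_refl mult_0)
  next
    case (Suc i)
    then have "bval b s" "runs c s m (I (Suc (N - Suc i)))" using step[of "N - Suc i" s] by auto
    moreover have "Suc (N - Suc i) = N - i" using Suc.prems by auto
    ultimately obtain t s' where 1: "exec c s t s'" "t \<le> m" "I (N - i) s'" unfolding runs_def by auto
    then obtain t' s'' where 2: "exec (While b c) s' t' s''" "t' \<le> i * (m + 1) + 1" "I N s''"
      using Suc.IH[of s'] Suc.prems unfolding runs_def by auto
    have "exec (While b c) s (t + t' + 1) s''" using exec.WhileTrue[OF \<open>bval b s\<close>] 1 2 by blast
    moreover have "t + t' + 1 \<le> Suc i * (m + 1) + 1" using 1 2 by simp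
    ultimately show ?case using 2(3) unfolding runs_def by blast
  qed
  from this[of N s] init have "runs (While b c) s (N * (m + 1) + 1) (I N)" by simp
  then show ?thesis by (rule runs_mono) (use m' in auto)
qed

section \<open>The program\<close>

abbreviation Var :: "string \<Rightarrow> aexp" where "Var x \<equiv> Load x (Const 0)"
abbreviation Set :: "string \<Rightarrow> aexp \<Rightarrow> com" where "Set x a \<equiv> Store x (Const 0) a"

text \<open>The array \<open>flag\<close> is the indicator function of the set of all \<open>y\<close> with \<open>\<bar>y\<bar> \<in> W\<close>.\<close>

definition mark_input :: com where
  "mark_input =
    Seq (Set ''i'' (Const 0))
      (While (Less (Var ''i'') (Var ''size''))
        (Seq (Store ''flag'' (Load ''W'' (Var ''i'')) (Const 1))
        (Seq (Store ''flag'' (Sub (Const 0) (Load ''W'' (Var ''i''))) (Const 1))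
          (Set ''i'' (Add (Var ''i'') (Const 1))))))"

text \<open>The loop goes through the whole array even after a failed test, so its length is known
  beforehand.\<close>

definition test_candidate :: com where
  "test_candidate =
    Seq (Set ''ok'' (Const 1))
    (Seq (Set ''j'' (Const 0))
    (Seq (While (Less (Var ''j'') (Var ''outsize''))
        (Seq (Cond (Less (Const 0) (Load ''flag'' (Sub (Var ''x'') (Load ''out'' (Var ''j''))))) Skip
               (Set ''ok'' (Const 0)))
          (Set ''j'' (Add (Var ''j'') (Const 1)))))
      (Cond (Less (Const 0) (Var ''ok''))
        (Seq (Store ''out'' (Var ''outsize'') (Var ''x''))
          (Set ''outsize'' (Add (Var ''outsize'') (Const 1))))
        Skip)))"

definition scan :: com where
  "scan =
    Seq (Set ''d'' (Const 1))
      (While (Less (Var ''d'') (Var ''max''))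
        (Seq (Set ''x'' (Var ''d''))
        (Seq test_candidate
        (Seq (Set ''x'' (Sub (Var ''max'') (Var ''d'')))
        (Seq test_candidate
          (Set ''d'' (Add (Var ''d'') (Const 1))))))))"

text \<open>For empty \<open>W\<close> the maximum is read from address \<open>-1\<close>, which
  holds 0. The guard then leaves \<open>outsize\<close> at 0, so that the output is the empty set
  and not \<open>{0}\<close>.\<close>

definition recover :: com where
  "recover =
    Seq mark_input
    (Seq (Set ''max'' (Load ''W'' (Sub (Var ''size'') (Const 1))))
    (Seq (Store ''out'' (Const 0) (Const 0))
    (Seq (Store ''out'' (Const 1) (Var ''max''))
    (Seq (Cond (Less (Const 0) (Var ''size'')) (Set ''outsize'' (Const 2)) Skip)
      scan))))"

definition flags :: "int set \<Rightarrow> memory \<Rightarrow> bool" where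
  "flags W s \<longleftrightarrow> (\<forall>y. s ''flag'' y = (if \<bar>y\<bar> \<in> W then 1 else 0))"

section \<open>Verification of the program\<close>

lemma runs_mark_input:
  fixes W :: "int set"
  assumes fin: "finite W" and pos: "\<And>w. w \<in> W \<Longrightarrow> 0 \<le> w" and s: "s = input_memory n k W"
  shows "runs mark_input s (4 * card W + 2) (\<lambda>s'. flags W s' \<and>
    (\<forall>x\<in>{''size'', ''W'', ''outsize''}. s' x = s x))"
proof -
  define xs where "xs = sorted_list_of_set W"
  have xs: "length xs = card W" "set xs = W" using fin by (auto simp: xs_def)
  define I where "I = (\<lambda>j s'. s' ''i'' 0 = int j \<and>
     (\<forall>y. s' ''flag'' y = (if \<bar>y\<bar> \<in> set (take j xs) then 1 else 0)) \<and>
     (\<forall>x\<in>{''size'', ''W'', ''outsize''}. s' x = s x))"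
  have size: "s ''size'' 0 = int (card W)" by (simp add: s input_memory_def)
  have W: "s ''W'' (int j) = xs ! j" if "j < card W" for j
    using that by (simp add: s input_memory_def xs_def)
  show ?thesis unfolding mark_input_def
  proof (rule runs_mono[where P = "I (card W)", OF runs_Store_Seq[OF
        runs_While[where I = I and N = "card W" and m = 3, OF _ _ _ le_refl] le_refl]])
    fix j s' assume j: "j < card W" "I j s'"
    define w where "w = xs ! j"
    have w: "s' ''W'' (int j) = w" "w \<in> W"
      using j W nth_mem[of j xs] xs by (auto simp: w_def I_def)
    have tk: "set (take (Suc j) xs) = insert w (set (take j xs))"
      using j(1) by (simp add: take_Suc_conv_app_nth xs(1) w_def)
    have "0 \<le> w" using pos w by blast
    then have "\<bar>y\<bar> = w \<longleftrightarrow> y = w \<or> y = - w" for y by auto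
    then show "bval (Less (Var ''i'') (Var ''size'')) s' \<and> runs
        (Seq (Store ''flag'' (Load ''W'' (Var ''i'')) (Const 1))
        (Seq (Store ''flag'' (Sub (Const 0) (Load ''W'' (Var ''i''))) (Const 1))
          (Set ''i'' (Add (Var ''i'') (Const 1))))) s' 3 (I (Suc j))"
      using j w size
      by (intro conjI runs_Store_Seq[where b = 2, OF runs_Store_Seq[where b = 1, OF runs_Store]])
        (auto simp: I_def tk)
  qed (use xs size in \<open>auto simp: I_def flags_def s input_memory_def\<close>)
qed

text \<open>Here \<open>l\<close> counts array entries, not elements: a kept candidate is stored
  again if it passes its second test. Time bounds therefore rest on the number of tests.\<close>

definition out_list :: "memory \<Rightarrow> int set \<Rightarrow> nat \<Rightarrow> bool" where
  "out_list s T l \<longleftrightarrow> s ''outsize'' 0 = int l \<and> T = s ''out'' ` {0..<int l}"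

lemma runs_test_candidate:
  assumes s: "flags W s" "out_list s T l" "s ''x'' 0 = x" "l \<le> b"
  shows "runs test_candidate s (5 * b + 6) (\<lambda>s'. flags W s' \<and> s' ''max'' = s ''max'' \<and> s' ''d'' = s ''d'' \<and>
     (\<exists>l'. out_list s' (extend W x T) l' \<and> l' \<le> Suc l))"
proof -
  define I where "I = (\<lambda>j s'. s' ''j'' 0 = int j \<and>
     s' ''ok'' 0 = (if compatible W (s ''out'' ` {0..<int j}) x then 1 else 0) \<and>
     (\<forall>y\<in>{''flag'', ''out'', ''outsize'', ''x'', ''max'', ''d''}. s' y = s y))"
  have fl: "s ''flag'' y = (if \<bar>y\<bar> \<in> W then 1 else 0)" for y using s(1) by (simp add: flags_def)
  have ivl: "{0..<1 + int j} = insert (int j) {0..<int j}" for j by auto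
  show ?thesis unfolding test_candidate_def
  proof (rule runs_Store_Seq[OF runs_Store_Seq[OF runs_Seq[OF
         runs_While[where I = I and N = l and m = 3, OF _ _ _ le_refl] _ le_refl] le_refl]])
    fix j s' assume j: "j < l" "I j s'"
    show "bval (Less (Var ''j'') (Var ''outsize'')) s' \<and> runs
        (Seq (Cond (Less (Const 0) (Load ''flag'' (Sub (Var ''x'') (Load ''out'' (Var ''j''))))) Skip
               (Set ''ok'' (Const 0)))
          (Set ''j'' (Add (Var ''j'') (Const 1)))) s' 3 (I (Suc j))"
    proof
      show "bval (Less (Var ''j'') (Var ''outsize'')) s'" using j s by (auto simp: I_def out_list_def)
      define J where "J = (\<lambda>s'. s' ''j'' 0 = int j \<and>
         s' ''ok'' 0 = (if compatible W (s ''out'' ` {0..<int (Suc j)}) x then 1 else 0) \<and>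
         (\<forall>y\<in>{''flag'', ''out'', ''outsize'', ''x'', ''max'', ''d''}. s' y = s y))"
      show "runs
        (Seq (Cond (Less (Const 0) (Load ''flag'' (Sub (Var ''x'') (Load ''out'' (Var ''j''))))) Skip
               (Set ''ok'' (Const 0)))
          (Set ''j'' (Add (Var ''j'') (Const 1)))) s' 3 (I (Suc j))"
      proof (rule runs_Seq[where P = J and ?b1.0 = 2 and ?b2.0 = 1, OF runs_Cond[where m = 1]])
        have img: "s ''out'' ` {0..<int (Suc j)} = insert (s ''out'' (int j)) (s ''out'' ` {0..<int j})"
          using ivl[of j] by simp
        have test: "bval (Less (Const 0) (Load ''flag'' (Sub (Var ''x'') (Load ''out'' (Var ''j''))))) s'
            \<longleftrightarrow> \<bar>x - s ''out'' (int j)\<bar> \<in> W"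
          using j s(3) fl by (simp add: I_def)
        show "runs Skip s' 1 J"
          if "bval (Less (Const 0) (Load ''flag'' (Sub (Var ''x'') (Load ''out'' (Var ''j''))))) s'"
          using that j unfolding test
          by (intro runs_Skip) (simp_all add: I_def J_def img compatible_def del: of_nat_Suc)
        show "runs (Set ''ok'' (Const 0)) s' 1 J"
          if "\<not> bval (Less (Const 0) (Load ''flag'' (Sub (Var ''x'') (Load ''out'' (Var ''j''))))) s'"
          using that j unfolding test
          by (intro runs_Store) (simp_all add: I_def J_def img compatible_def del: of_nat_Suc)
        show "runs (Set ''j'' (Add (Var ''j'') (Const 1))) s2 1 (I (Suc j))" if "J s2" for s2
          using that by (intro runs_Store) (simp_all add: I_def J_def)
      qed simp_all
    qed
  next
    fix s' assume I: "I l s'"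
    show "runs (Cond (Less (Const 0) (Var ''ok''))
        (Seq (Store ''out'' (Var ''outsize'') (Var ''x''))
          (Set ''outsize'' (Add (Var ''outsize'') (Const 1)))) Skip) s' 3 
       (\<lambda>s'. flags W s' \<and> s' ''max'' = s ''max'' \<and> s' ''d'' = s ''d'' \<and>
     (\<exists>l'. out_list s' (extend W x T) l' \<and> l' \<le> Suc l))"
    proof (rule runs_Cond[where m = 2])
      assume "bval (Less (Const 0) (Var ''ok'')) s'"
      then have "compatible W T x" using I s(2) by (auto simp: I_def out_list_def split: if_splits)
      then show "runs (Seq (Store ''out'' (Var ''outsize'') (Var ''x''))
          (Set ''outsize'' (Add (Var ''outsize'') (Const 1)))) s' 2 
       (\<lambda>s'. flags W s' \<and> s' ''max'' = s ''max'' \<and> s' ''d'' = s ''d'' \<and>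
     (\<exists>l'. out_list s' (extend W x T) l' \<and> l' \<le> Suc l))"
        using I s
        by (intro runs_Store_Seq[OF runs_Store[OF _ le_refl]])
          (auto simp: I_def flags_def extend_def out_list_def ivl intro!: exI[of _ "Suc l"])
    next
      assume "\<not> bval (Less (Const 0) (Var ''ok'')) s'"
      then have "\<not> compatible W T x" using I s(2) by (auto simp: I_def out_list_def split: if_splits)
      then show "runs Skip s' 2 
       (\<lambda>s'. flags W s' \<and> s' ''max'' = s ''max'' \<and> s' ''d'' = s ''d'' \<and>
     (\<exists>l'. out_list s' (extend W x T) l' \<and> l' \<le> Suc l))"
        using I s by (intro runs_Skip) (auto simp: I_def flags_def extend_def out_list_def intro!: exI[of _ l])
    qed simp
  qed (use s in \<open>auto simp: I_def compatible_def out_list_def\<close>)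
qed

text \<open>The second alternative for \<open>T\<close> covers empty \<open>W\<close>, where the
  array starts empty and the loop body never runs.\<close>

lemma runs_scan:
  assumes s: "flags W s" "out_list s T l" "l \<le> 2" "s ''max'' 0 = M" "nat M - 1 \<le> b"
    and T: "T = greedy W M 0 \<or> nat M - 1 = 0"
  shows "runs scan s (b * (20 * b + 41) + 2)
    (\<lambda>s'. \<exists>l. out_list s' (if nat M - 1 = 0 then T else greedy W M (nat M - 1)) l)"
proof -
  define N where "N = nat M - 1"
  define I where "I = (\<lambda>j s'. flags W s' \<and> s' ''max'' = s ''max'' \<and> s' ''d'' 0 = int (Suc j) \<and>
     (\<exists>l'. out_list s' (if N = 0 then T else greedy W M j) l' \<and> l' \<le> 2 + 2 * j))"
  let ?body = "Seq (Set ''x'' (Var ''d''))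
        (Seq test_candidate
        (Seq (Set ''x'' (Sub (Var ''max'') (Var ''d'')))
        (Seq test_candidate
          (Set ''d'' (Add (Var ''d'') (Const 1))))))"
  have body: "runs ?body s1 (20 * b + 40) (I (Suc j))" if j: "j < N" "I j s1" for j s1
  proof -
    define G where "G = greedy W M j"
    define G1 where "G1 = extend W (int (Suc j)) G"
    obtain l1 where l1: "out_list s1 G l1" "l1 \<le> 2 + 2 * j" using j by (auto simp: I_def G_def)
    have jb: "Suc j \<le> b" using j s(5) by (simp add: N_def)
    define J where "J = (\<lambda>s'. flags W s' \<and> s' ''max'' = s ''max'' \<and> s' ''d'' = s1 ''d'' \<and>
      (\<exists>l'. out_list s' G1 l' \<and> l' \<le> 3 + 2 * j))"
    define K where "K = (\<lambda>s'. flags W s' \<and> s' ''max'' = s ''max'' \<and> s' ''d'' = s1 ''d'' \<and>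
      (\<exists>l'. out_list s' (greedy W M (Suc j)) l' \<and> l' \<le> 4 + 2 * j))"
    have d: "s1 ''d'' 0 = int (Suc j)" "s1 ''max'' = s ''max''" "flags W s1" using j by (auto simp: I_def)
    \<comment> \<open>After \<open>j\<close> rounds at most \<open>2 + 2 * j\<close> entries are
      stored, which is at most \<open>2 * b\<close>; the second test may find one more.\<close>
    have 1: "runs test_candidate (s1(''x'' := (s1 ''x'')(aval (Const 0) s1 := aval (Var ''d'') s1))) (10 * b + 6) J"
      by (rule runs_mono[OF runs_test_candidate[where T = G and W = W and l = l1 and b = "2 * b"]])
        (use l1 d jb in \<open>auto simp: flags_def out_list_def J_def G1_def\<close>)
    have 2: "runs test_candidate (s2(''x'' := (s2 ''x'')(aval (Const 0) s2 := aval (Sub (Var ''max'') (Var ''d'')) s2)))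
        (10 * b + 11) K" if s2: "J s2" for s2
    proof -
      obtain l2 where l2: "out_list s2 G1 l2" "l2 \<le> 3 + 2 * j" using s2 by (auto simp: J_def)
      show ?thesis
        by (rule runs_mono[OF runs_test_candidate[where T = G1 and W = W and l = l2 and b = "2 * b + 1"]])
          (use l2 d jb s2 s(4) in \<open>auto simp: flags_def out_list_def J_def K_def G1_def G_def\<close>)
    qed
    have 3: "runs (Set ''d'' (Add (Var ''d'') (Const 1))) s3 1 (I (Suc j))" if "K s3" for s3
      by (rule runs_Store) (use that j d in \<open>auto simp: I_def K_def flags_def out_list_def\<close>)
    have "runs (Seq test_candidate (Set ''d'' (Add (Var ''d'') (Const 1))))
       (s2(''x'' := (s2 ''x'')(aval (Const 0) s2 := aval (Sub (Var ''max'') (Var ''d'')) s2))) (10 * b + 12) (I (Suc j))"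
      if "J s2" for s2
      by (rule runs_Seq[OF 2 3]) (use that in auto)
    then have "runs (Seq (Set ''x'' (Sub (Var ''max'') (Var ''d''))) (Seq test_candidate
          (Set ''d'' (Add (Var ''d'') (Const 1))))) s2 (10 * b + 13) (I (Suc j))" if "J s2" for s2
      by (rule runs_Store_Seq) (use that in auto)
    then have "runs (Seq test_candidate (Seq (Set ''x'' (Sub (Var ''max'') (Var ''d''))) (Seq test_candidate
          (Set ''d'' (Add (Var ''d'') (Const 1))))))
          (s1(''x'' := (s1 ''x'')(aval (Const 0) s1 := aval (Var ''d'') s1))) (20 * b + 19) (I (Suc j))"
      by (rule runs_Seq[OF 1]) auto
    then show ?thesis by (rule runs_Store_Seq) auto
  qed
  show ?thesis unfolding scan_def
  proof (rule runs_mono[where P = "I N", OF runs_Store_Seq[OF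
      runs_While[where I = I and N = N and m = "20 * b + 40", OF _ _ _ le_refl] le_refl]])
    fix j s1 assume j: "j < N" "I j s1"
    then show "bval (Less (Var ''d'') (Var ''max'')) s1 \<and> runs ?body s1 (20 * b + 40) (I (Suc j))"
      using body[OF j] s(4) by (auto simp: I_def N_def)
  next
    show "N * (20 * b + 40 + 1) + 1 + 1 \<le> b * (20 * b + 41) + 2"
      using mult_le_mono1[OF s(5), of "20 * b + 41"] by (simp add: N_def algebra_simps)
  qed (use s T in \<open>auto simp: I_def N_def flags_def out_list_def split: if_splits\<close>)
qed

text \<open>The case split avoids \<open>Max {}\<close>, which has no useful value.\<close>

definition max_scan :: "int set \<Rightarrow> int set" where
  "max_scan W = (if W = {} then {} else greedy W (Max W) (nat (Max W) - 1))"

lemma runs_recover: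
  fixes W :: "int set"
  assumes W: "finite W" "W \<subseteq> {0..int n}"
  shows "runs recover (input_memory n k W) (20 * n * n + 45 * n + 20) (\<lambda>s'. output_set s' = max_scan W)"
proof -
  define s where "s = input_memory n k W"
  define M where "M = (if W = {} then 0 else Max W)"
  have card: "card W \<le> n + 1"
    using card_mono[OF _ W(2)] by simp
  have M: "s ''W'' (s ''size'' 0 - 1) = M"
  proof (cases "W = {}")
    case False
    then have c: "card W > 0" using W(1) by (simp add: card_gt_0_iff)
    then have "s ''W'' (s ''size'' 0 - 1) = sorted_list_of_set W ! (card W - 1)"
      by (simp add: s_def input_memory_def nat_diff_distrib)
    also have "\<dots> = Max W"
    proof (rule Max_eqI[symmetric])
      show "sorted_list_of_set W ! (card W - 1) \<in> W"
        using nth_mem[of "card W - 1" "sorted_list_of_set W"] c W(1) by simp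
      fix y assume "y \<in> W"
      then obtain i where "i < card W" "y = sorted_list_of_set W ! i"
        using W(1) by (metis in_set_conv_nth length_sorted_list_of_set set_sorted_list_of_set)
      then show "y \<le> sorted_list_of_set W ! (card W - 1)"
        by (auto intro!: sorted_nth_mono)
    qed (rule W(1))
    finally show ?thesis using False by (simp add: M_def)
  qed (simp add: s_def input_memory_def M_def)
  have "W \<noteq> {} \<Longrightarrow> Max W \<le> int n" using W Max_in[OF W(1)] by force
  then have Mn: "nat M \<le> n" by (auto simp: M_def nat_le_iff)
  define T where "T = (if W = {} then {} else {0, M})"
  define J where "J = (\<lambda>s'. flags W s' \<and> (\<forall>x\<in>{''size'', ''W'', ''outsize''}. s' x = s x))"
  have 1: "runs mark_input s (4 * card W + 2) J"
    unfolding J_def by (rule runs_mark_input) (use W s_def in auto)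
  define K where "K = (\<lambda>s'. flags W s' \<and> s' ''max'' 0 = M \<and> (\<exists>l\<le>2. out_list s' T l))"
  have size: "s ''size'' 0 = int (card W)" "s ''outsize'' 0 = 0" by (simp_all add: s_def input_memory_def)
  have pos: "0 < card W \<longleftrightarrow> W \<noteq> {}" using W(1) by (simp add: card_gt_0_iff)
  have ivl: "{0..<2::int} = {0, 1}" by auto
  have 2: "runs (Cond (Less (Const 0) (Var ''size'')) (Set ''outsize'' (Const 2)) Skip) s2 2 K"
    if "flags W s2" "s2 ''max'' 0 = M" "s2 ''size'' 0 = int (card W)" "s2 ''outsize'' 0 = 0"
      "s2 ''out'' 0 = 0" "s2 ''out'' 1 = M" for s2
  proof (rule runs_Cond[where m = 1])
    assume "bval (Less (Const 0) (Var ''size'')) s2"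
    then have "W \<noteq> {}" using that(3) pos by simp
    then show "runs (Set ''outsize'' (Const 2)) s2 1 K"
      by (intro runs_Store) (use that in \<open>auto intro!: exI[of _ 2] simp: K_def T_def flags_def out_list_def ivl\<close>)
  next
    assume "\<not> bval (Less (Const 0) (Var ''size'')) s2"
    then have "W = {}" using that(3) pos by simp
    then show "runs Skip s2 1 K"
      by (intro runs_Skip) (use that in \<open>auto simp: K_def T_def out_list_def\<close>)
  qed simp
  have 3: "runs scan s3 (n * (20 * n + 41) + 2) (\<lambda>s'. output_set s' = max_scan W)" if s3: "K s3" for s3
  proof -
    obtain l where l: "l \<le> 2" "out_list s3 T l" using s3 by (auto simp: K_def)
    show ?thesis
    proof (rule runs_mono[OF runs_scan[where W = W and M = M and T = T and l = l and b = n]])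
      fix s' assume "\<exists>l. out_list s' (if nat M - 1 = 0 then T else greedy W M (nat M - 1)) l"
      then have "output_set s' = (if nat M - 1 = 0 then T else greedy W M (nat M - 1))"
        by (auto simp: out_list_def output_set_def)
      also have "\<dots> = max_scan W" by (auto simp: max_scan_def T_def M_def)
      finally show "output_set s' = max_scan W" .
    qed (use s3 l Mn in \<open>auto simp: K_def T_def M_def\<close>)
  qed
  show ?thesis unfolding recover_def s_def[symmetric]
  proof (rule runs_Seq[OF 1])
    fix s1 assume s1: "J s1"
    show "runs (Seq (Set ''max'' (Load ''W'' (Sub (Var ''size'') (Const 1))))
      (Seq (Store ''out'' (Const 0) (Const 0))
      (Seq (Store ''out'' (Const 1) (Var ''max''))
      (Seq (Cond (Less (Const 0) (Var ''size'')) (Set ''outsize'' (Const 2)) Skip)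
        scan)))) s1 (2 + (n * (20 * n + 41) + 2) + 1 + 1 + 1) (\<lambda>s'. output_set s' = max_scan W)"
      by (rule runs_Store_Seq[OF runs_Store_Seq[OF runs_Store_Seq[OF runs_Seq[OF 2 3 le_refl] le_refl] le_refl] le_refl])
        (use s1 M size in \<open>auto simp: J_def flags_def\<close>)
  qed (use card in \<open>simp add: algebra_simps\<close>)
qed

section \<open>Counting functions with additive relations\<close>

text \<open>A bad function is determined by \<open>y\<close>, its restriction off \<open>y\<close>,
  and a value from a list of at most \<open>B\<close>. The set \<open>C y\<close> keeps what is
  known about the restriction; for chains this is a shorter chain, which allows induction.\<close>

lemma card_expose:
  fixes Bad :: "(nat \<Rightarrow> int) set"
  assumes I: "finite I" and Bad: "\<And>f. f \<in> Bad \<Longrightarrow> f \<in> extensional I"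
    and y: "\<And>f. f \<in> Bad \<Longrightarrow> \<exists>y\<in>I. restrict f (I - {y}) \<in> C y \<and> f y \<in> R y (restrict f (I - {y}))"
    and C: "\<And>y. y \<in> I \<Longrightarrow> finite (C y)"
    and R: "\<And>y g. y \<in> I \<Longrightarrow> g \<in> C y \<Longrightarrow> finite (R y g) \<and> card (R y g) \<le> B"
  shows "finite Bad \<and> card Bad \<le> (\<Sum>y\<in>I. card (C y)) * B"
proof -
  define X where "X = (\<lambda>y. (\<lambda>(g, v). g(y := v)) ` (SIGMA g:C y. R y g))"
  have sub: "Bad \<subseteq> (\<Union>y\<in>I. X y)"
  proof
    fix f assume f: "f \<in> Bad"
    then obtain y where y: "y \<in> I" "restrict f (I - {y}) \<in> C y" "f y \<in> R y (restrict f (I - {y}))"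
      using y by blast
    have "f = (\<lambda>(g, v). g(y := v)) (restrict f (I - {y}), f y)"
      using Bad[OF f] y(1) by (auto simp: fun_eq_iff extensional_def restrict_def)
    then have "f \<in> X y" unfolding X_def using y(2,3) by (intro image_eqI) auto
    with y(1) show "f \<in> (\<Union>y\<in>I. X y)" by blast
  qed
  have X: "finite (X y) \<and> card (X y) \<le> card (C y) * B" if y: "y \<in> I" for y
  proof
    have fin: "finite (SIGMA g:C y. R y g)" using C R y by auto
    then show "finite (X y)" unfolding X_def by simp
    have "card (X y) \<le> card (SIGMA g:C y. R y g)" unfolding X_def using fin by (rule card_image_le)
    also have "\<dots> = (\<Sum>g\<in>C y. card (R y g))" using C R y by (intro card_SigmaI) auto
    also have "\<dots> \<le> (\<Sum>g\<in>C y. B)" using R y by (intro sum_mono) auto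
    finally show "card (X y) \<le> card (C y) * B" by simp
  qed
  have fin: "finite (\<Union>y\<in>I. X y)" using I X by blast
  have "card Bad \<le> card (\<Union>y\<in>I. X y)" using card_mono[OF fin sub] .
  also have "\<dots> \<le> (\<Sum>y\<in>I. card (X y))" using I by (rule card_UN_le)
  also have "\<dots> \<le> (\<Sum>y\<in>I. card (C y) * B)" using X by (intro sum_mono) blast
  finally show ?thesis using fin sub finite_subset by (simp add: sum_distrib_right) blast
qed

definition hits :: "nat set \<Rightarrow> int set \<Rightarrow> (nat \<Rightarrow> int) \<Rightarrow> nat set" where
  "hits I S f = {i \<in> I. f i \<in> S}"

lemma finite_hits [simp]: "finite I \<Longrightarrow> finite (hits I S f)"
  by (simp add: hits_def)

lemma card_hits_restrict:
  assumes "finite I"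
  shows "card (hits (I - {y}) S (restrict f (I - {y}))) \<le> card (hits I S f)"
  using assms by (intro card_mono) (auto simp: hits_def)

lemma card_funs: "finite I \<Longrightarrow> card (I \<rightarrow>\<^sub>E {0..<int n}) = n ^ card I"
  by (simp add: card_PiE)

lemma finite_funs [simp]: "finite I \<Longrightarrow> finite (I \<rightarrow>\<^sub>E {0..<int n})"
  by (simp add: finite_PiE)

text \<open>The cap on window hits passes to the restriction, where it bounds the number of values
  left for \<open>f y\<close>. Relative to all functions the bound is
  \<open>k * B / n\<close>.\<close>

lemma card_expose_funs:
  fixes Bad :: "(nat \<Rightarrow> int) set"
  assumes Bad: "Bad \<subseteq> {f \<in> {..<k} \<rightarrow>\<^sub>E {0..<int n}. card (hits {..<k} S f) \<le> Q}"
    and y: "\<And>f. f \<in> Bad \<Longrightarrow> \<exists>y<k. f y \<in> R y (restrict f ({..<k} - {y}))"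
    and R: "\<And>y g. y < k \<Longrightarrow> card (hits ({..<k} - {y}) S g) \<le> Q \<Longrightarrow> finite (R y g) \<and> card (R y g) \<le> B"
  shows "card Bad \<le> k * n ^ (k - 1) * B"
proof -
  define C where "C = (\<lambda>y. {g \<in> ({..<k} - {y}) \<rightarrow>\<^sub>E {0..<int n}. card (hits ({..<k} - {y}) S g) \<le> Q})"
  have *: "finite Bad \<and> card Bad \<le> (\<Sum>y\<in>{..<k}. card (C y)) * B"
  proof (rule card_expose[where R = R])
    fix f assume f: "f \<in> Bad"
    then show "f \<in> extensional {..<k}" using Bad by (auto simp: PiE_def)
    obtain y where y: "y < k" "f y \<in> R y (restrict f ({..<k} - {y}))" using assms(2) f by blast
    have "restrict f ({..<k} - {y}) \<in> C y"
      unfolding C_def using f Bad card_hits_restrict[of "{..<k}" y S f] by (auto simp: subset_iff)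
    then show "\<exists>y\<in>{..<k}. restrict f ({..<k} - {y}) \<in> C y \<and> f y \<in> R y (restrict f ({..<k} - {y}))"
      using y by blast
  qed (use R in \<open>auto simp: C_def\<close>)
  have "card (C y) \<le> n ^ (k - 1)" if "y < k" for y
  proof -
    have "card (C y) \<le> card (({..<k} - {y}) \<rightarrow>\<^sub>E {0..<int n})"
      unfolding C_def by (intro card_mono) auto
    also have "\<dots> = n ^ (k - 1)" using that by (subst card_funs) auto
    finally show ?thesis .
  qed
  then have "(\<Sum>y\<in>{..<k}. card (C y)) \<le> (\<Sum>y\<in>{..<k}. n ^ (k - 1))" by (intro sum_mono) auto
  then have "(\<Sum>y\<in>{..<k}. card (C y)) * B \<le> k * n ^ (k - 1) * B" by (intro mult_le_mono1) simp
  with * show ?thesis by linarith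
qed

lemma sum_list_split_count:
  fixes xs :: "int list"
  shows "sum_list xs = int (count (mset xs) z) * z + sum_list (map (\<lambda>x. if x = z then 0 else x) xs)"
  by (induction xs) (auto simp: algebra_simps)

definition additive_coincidence :: "nat \<Rightarrow> int set \<Rightarrow> bool" where
  "additive_coincidence h E \<longleftrightarrow> (\<exists>xs ys. length xs = h \<and> length ys = h \<and> set xs \<subseteq> E \<and> set ys \<subseteq> E \<and>
     sum_list xs = sum_list ys \<and> mset xs \<noteq> mset ys)"

text \<open>Some \<open>z\<close> has different multiplicities on the two sides. Collecting its
  occurrences gives \<open>c * z\<close> with \<open>c \<noteq> 0\<close> and
  \<open>\<bar>c\<bar> \<le> h\<close>, so \<open>z\<close> is determined by \<open>c\<close> and
  the other entries. Removed occurrences become 0, keeping both lists at length \<open>h\<close>;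
  hence \<open>Q + 1\<close> choices per entry.\<close>

lemma card_additive_coincidence:
  "card {f \<in> {..<k} \<rightarrow>\<^sub>E {0..<int n}. card (hits {..<k} S f) \<le> Q \<and> additive_coincidence h (f ` {..<k} \<inter> S)}
    \<le> k * n ^ (k - 1) * ((2 * h + 1) * (Q + 1) ^ (2 * h))"
proof -
  define H where "H = (\<lambda>y g. insert 0 (g ` hits ({..<k} - {y}) S g) :: int set)"
  define Ls where "Ls = (\<lambda>y g. {xs. set xs \<subseteq> H y g \<and> length xs = h})"
  define R where "R = (\<lambda>y g. (\<lambda>(c, xs, ys). (sum_list ys - sum_list xs) div c) `
     ({- int h..int h} \<times> Ls y g \<times> Ls y g))"
  have H: "finite (H y g)" for y g by (simp add: H_def)
  have Ls: "finite (Ls y g)" "card (Ls y g) = card (H y g) ^ h" for y g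
    unfolding Ls_def using H by (auto simp: finite_lists_length_eq card_lists_length_eq)
  show ?thesis
  proof (rule card_expose_funs[where R = R and S = S and Q = Q])
    fix y g assume "y < k" and g: "card (hits ({..<k} - {y}) S g) \<le> Q"
    have "card (H y g) \<le> Suc (card (g ` hits ({..<k} - {y}) S g))" unfolding H_def by (rule card_insert_le_m1) auto
    also have "\<dots> \<le> Q + 1" using g card_image_le[of "hits ({..<k} - {y}) S g" g] by simp
    finally have "card (H y g) ^ h \<le> (Q + 1) ^ h" by (rule power_mono) simp
    then have "card (Ls y g) \<le> (Q + 1) ^ h" by (simp only: Ls(2))
    from mult_le_mono[OF this this]
    have "card (Ls y g) * card (Ls y g) \<le> (Q + 1) ^ h * (Q + 1) ^ h" .
    moreover have "card (R y g) \<le> card ({- int h..int h} \<times> Ls y g \<times> Ls y g)"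
      unfolding R_def using Ls by (intro card_image_le) auto
    moreover have "\<dots> = (2 * h + 1) * (card (Ls y g) * card (Ls y g))"
    proof -
      have "nat (2 * int h + 1) = 2 * h + 1" by simp
      then show ?thesis by (simp only: card_cartesian_product card_atLeastAtMost_int) simp
    qed
    ultimately have "card (R y g) \<le> (2 * h + 1) * ((Q + 1) ^ h * (Q + 1) ^ h)"
      by (metis (no_types, lifting) le_trans mult_le_mono2)
    then show "finite (R y g) \<and> card (R y g) \<le> (2 * h + 1) * (Q + 1) ^ (2 * h)"
      using Ls by (simp add: R_def power_add mult_2)
  next
    fix f assume "f \<in> {f \<in> {..<k} \<rightarrow>\<^sub>E {0..<int n}. card (hits {..<k} S f) \<le> Q \<and>
      additive_coincidence h (f ` {..<k} \<inter> S)}"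
    then obtain xs ys where xy: "length xs = h" "length ys = h" "set xs \<subseteq> f ` {..<k} \<inter> S"
        "set ys \<subseteq> f ` {..<k} \<inter> S" "sum_list xs = sum_list ys" "mset xs \<noteq> mset ys"
      unfolding additive_coincidence_def by blast
    then obtain z where z: "count (mset xs) z \<noteq> count (mset ys) z" by (meson multiset_eqI)
    then have "z \<in># mset xs \<or> z \<in># mset ys" by (metis count_eq_zero_iff)
    then have "z \<in> f ` {..<k} \<inter> S" using xy(3,4) by auto
    then obtain y where y: "y < k" "z = f y" by blast
    let ?g = "restrict f ({..<k} - {y})"
    let ?r = "\<lambda>x. if x = z then 0 else x"
    have mem: "map ?r xs' \<in> Ls y ?g" if xs': "length xs' = h" "set xs' \<subseteq> f ` {..<k} \<inter> S" for xs'
    proof -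
      have "?r x \<in> H y ?g" if x: "x \<in> set xs'" for x
      proof (cases "x = z")
        case False
        obtain i where i: "i < k" "x = f i" "x \<in> S" using xs'(2) x by blast
        with False y have "i \<in> hits ({..<k} - {y}) S ?g" "?g i = x" by (auto simp: hits_def)
        with False show ?thesis unfolding H_def by force
      qed (simp add: H_def)
      then have "set (map ?r xs') \<subseteq> H y ?g" unfolding set_map by blast
      then show ?thesis unfolding Ls_def using xs'(1) by simp
    qed
    define c where "c = int (count (mset xs) z) - int (count (mset ys) z)"
    have "count (mset xs) z \<le> h" "count (mset ys) z \<le> h"
      using count_le_size[of "mset xs" z] count_le_size[of "mset ys" z] xy(1,2) by auto
    then have c: "c \<noteq> 0" "c \<in> {- int h..int h}" using z unfolding c_def by auto
    have "c * z = sum_list (map ?r ys) - sum_list (map ?r xs)"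
      using xy(5) sum_list_split_count[of xs z] sum_list_split_count[of ys z]
      by (simp add: c_def algebra_simps)
    then have "z = (sum_list (map ?r ys) - sum_list (map ?r xs)) div c"
      using c(1) by (metis nonzero_mult_div_cancel_left)
    then have "z = (\<lambda>(c, xs, ys). (sum_list ys - sum_list xs) div c) (c, map ?r xs, map ?r ys)" by simp
    moreover have "(c, map ?r xs, map ?r ys) \<in> {- int h..int h} \<times> Ls y ?g \<times> Ls y ?g"
      using c(2) mem xy by blast
    ultimately have "z \<in> R y ?g" unfolding R_def by (rule image_eqI)
    then show "\<exists>y<k. f y \<in> R y (restrict f ({..<k} - {y}))" using y by blast
  qed auto
qed

text \<open>Only \<open>y\<close> and \<open>q\<close> range over all indices; the other four are
  confined to the window. So the relation costs about \<open>k^2 Q^4 / n\<close>, which still tends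
  to 0 because \<open>k^2 / n\<close> decays like a power of \<open>n\<close>.\<close>

definition mixed_coincidence :: "int set \<Rightarrow> nat set \<Rightarrow> (nat \<Rightarrow> int) \<Rightarrow> bool" where
  "mixed_coincidence S I f \<longleftrightarrow> (\<exists>y\<in>I. \<exists>a\<in>hits (I - {y}) S f. \<exists>b\<in>hits (I - {y}) S f.
        \<exists>c\<in>hits (I - {y}) S f. \<exists>d\<in>hits (I - {y}) S f. \<exists>q\<in>I - {y}.
        f y = f a + f b - f c - f d + f q)"

lemma card_mixed_coincidence:
  "card {f \<in> {..<k} \<rightarrow>\<^sub>E {0..<int n}. card (hits {..<k} S f) \<le> Q \<and> mixed_coincidence S {..<k} f}
    \<le> k * n ^ (k - 1) * (Q ^ 4 * k)"
proof -
  define R where "R = (\<lambda>y g. (\<lambda>(a, b, c, d, q). g a + g b - g c - g d + g q :: int) `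
    (hits ({..<k} - {y}) S g \<times> hits ({..<k} - {y}) S g \<times> hits ({..<k} - {y}) S g \<times>
     hits ({..<k} - {y}) S g \<times> ({..<k} - {y})))"
  show ?thesis
  proof (rule card_expose_funs[where R = R and S = S and Q = Q])
    fix y g assume "y < k" and g: "card (hits ({..<k} - {y}) S g) \<le> Q"
    define H where "H = hits ({..<k} - {y}) S g"
    have "card (R y g) \<le> card (H \<times> H \<times> H \<times> H \<times> ({..<k} - {y}))"
      unfolding R_def H_def by (intro card_image_le) auto
    also have "\<dots> = card H ^ 4 * card ({..<k} - {y})" by (simp add: card_cartesian_product power4_eq_xxxx)
    also have "\<dots> \<le> Q ^ 4 * k" using g by (intro mult_mono power_mono) (auto simp: H_def card_Diff_subset_Int)
    finally show "finite (R y g) \<and> card (R y g) \<le> Q ^ 4 * k" by (simp add: R_def)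
  next
    fix f assume "f \<in> {f \<in> {..<k} \<rightarrow>\<^sub>E {0..<int n}. card (hits {..<k} S f) \<le> Q \<and> mixed_coincidence S {..<k} f}"
    then obtain y a b c d q where y: "y < k" "f y = f a + f b - f c - f d + f q"
      and H: "a \<in> hits ({..<k} - {y}) S f" "b \<in> hits ({..<k} - {y}) S f" "c \<in> hits ({..<k} - {y}) S f"
        "d \<in> hits ({..<k} - {y}) S f" "q \<in> {..<k} - {y}"
      unfolding mixed_coincidence_def by blast
    have "f y \<in> R y (restrict f ({..<k} - {y}))" unfolding R_def
      by (rule image_eqI[where x = "(a, b, c, d, q)"]) (use y H in \<open>auto simp: hits_def\<close>)
    with y(1) show "\<exists>y<k. f y \<in> R y (restrict f ({..<k} - {y}))" by blast
  qed auto
qed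

text \<open>The birthday bound.\<close>

lemma card_not_inj:
  "card {f \<in> {..<k} \<rightarrow>\<^sub>E {0..<int n}. \<not> inj_on f {..<k}} \<le> k * n ^ (k - 1) * k"
proof (rule card_expose_funs[where R = "\<lambda>y g. g ` ({..<k} - {y})" and S = UNIV and Q = k])
  fix f assume "f \<in> {f \<in> {..<k} \<rightarrow>\<^sub>E {0..<int n}. \<not> inj_on f {..<k}}"
  then obtain y z where "y < k" "z < k" "y \<noteq> z" "f y = f z" unfolding inj_on_def by blast
  then show "\<exists>y<k. f y \<in> restrict f ({..<k} - {y}) ` ({..<k} - {y})"
    by (intro exI[of _ y]) (auto intro!: image_eqI[of _ _ z])
next
  fix y g assume "y < k"
  have "card (g ` ({..<k} - {y})) \<le> card ({..<k} - {y})" by (rule card_image_le) auto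
  also have "\<dots> \<le> card {..<k}" by (rule card_mono) auto
  finally show "finite (g ` ({..<k} - {y})) \<and> card (g ` ({..<k} - {y})) \<le> k" by simp
qed (auto simp: hits_def)

section \<open>Chains of representations\<close>

text \<open>
  Each link \<open>y\<close> of a chain stands for a representation \<open>x = e + p - q\<close> with \<open>e\<close> in the window \<open>S\<close> in
  which \<open>p = f y\<close> or \<open>q = f y\<close>, and \<open>y\<close> occurs in no earlier link. So every link reduces the number of
  functions by a factor of about \<open>Q k\<^sup>2 / n\<close>, even though the links may share other elements.
\<close>

primrec chain :: "int \<Rightarrow> int set \<Rightarrow> nat \<Rightarrow> nat set \<Rightarrow> (nat \<Rightarrow> int) \<Rightarrow> bool" where
  "chain x S 0 I f \<longleftrightarrow> True"
| "chain x S (Suc l) I f \<longleftrightarrow> (\<exists>y\<in>I. chain x S l (I - {y}) f \<and>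
     (\<exists>t\<in>hits (I - {y}) S f. \<exists>q\<in>I - {y}. f y = x - f t + f q \<or> f y = f t + f q - x))"

lemma chain_cong:
  assumes "\<And>i. i \<in> J \<Longrightarrow> f i = g i"
  shows "chain x S l J f \<longleftrightarrow> chain x S l J g"
  using assms
proof (induction l arbitrary: J)
  case (Suc l)
  have 1: "hits (J - {y}) S f = hits (J - {y}) S g" for y
    using Suc.prems by (auto simp: hits_def)
  have 2: "chain x S l (J - {y}) f = chain x S l (J - {y}) g" for y
    by (rule Suc.IH) (use Suc.prems in auto)
  show ?case unfolding chain.simps 1 2
    by (intro bex_cong conj_cong refl) (simp add: Suc.prems hits_def)
qed simp

lemma chain_restrict: "chain x S l J (restrict f J) \<longleftrightarrow> chain x S l J f"
  by (rule chain_cong) simp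

lemma chain_mono: "chain x S l J f \<Longrightarrow> J \<subseteq> I \<Longrightarrow> chain x S l I f"
proof (induction l arbitrary: J I)
  case (Suc l)
  then obtain y t q where y: "y \<in> J" "chain x S l (J - {y}) f" "t \<in> hits (J - {y}) S f" "q \<in> J - {y}"
    "f y = x - f t + f q \<or> f y = f t + f q - x" by auto
  have "chain x S l (I - {y}) f" using Suc.IH[OF y(2), of "I - {y}"] Suc.prems(2) by blast
  moreover have "t \<in> hits (I - {y}) S f" "q \<in> I - {y}" "y \<in> I" using y Suc.prems(2) by (auto simp: hits_def)
  ultimately show ?case using y(5) by auto
qed simp

text \<open>Exposing the \<open>y\<close> of the outermost link leaves a shorter chain on
  \<open>I - {y}\<close>, to which the induction hypothesis applies. The factor
  \<open>2 * Q * k\<^sup>2\<close> counts \<open>y\<close>, \<open>t\<close>, \<open>q\<close> and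
  the sign; the power of \<open>n\<close> stands on the left to stay within natural numbers.\<close>

lemma card_chain:
  assumes "finite I" "card I \<le> k"
  shows "card {f \<in> I \<rightarrow>\<^sub>E {0..<int n}. card (hits I S f) \<le> Q \<and> chain x S l I f} * n ^ l
    \<le> (2 * Q * k\<^sup>2) ^ l * n ^ card I"
  using assms
proof (induction l arbitrary: I)
  case 0
  have "card {f \<in> I \<rightarrow>\<^sub>E {0..<int n}. card (hits I S f) \<le> Q} \<le> card (I \<rightarrow>\<^sub>E {0..<int n})"
    using 0 by (intro card_mono) auto
  also have "\<dots> = n ^ card I" using 0 by (simp add: card_funs)
  finally show ?case by simp
next
  case (Suc l)
  define C where "C = (\<lambda>y. {f \<in> (I - {y}) \<rightarrow>\<^sub>E {0..<int n}. card (hits (I - {y}) S f) \<le> Q \<and> chain x S l (I - {y}) f})"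
  define R where "R = (\<lambda>y f. (\<lambda>(t, q). x - f t + f q) ` (hits (I - {y}) S f \<times> (I - {y})) \<union>
     (\<lambda>(t, q). f t + f q - x) ` (hits (I - {y}) S f \<times> (I - {y})))"
  let ?Bad = "{f \<in> I \<rightarrow>\<^sub>E {0..<int n}. card (hits I S f) \<le> Q \<and> chain x S (Suc l) I f}"
  have "finite ?Bad \<and> card ?Bad \<le> (\<Sum>y\<in>I. card (C y)) * (2 * Q * k)"
  proof (rule card_expose[where R = R])
    fix f assume f: "f \<in> ?Bad"
    then show "f \<in> extensional I" by (auto simp: PiE_def)
    from f obtain y t q where y: "y \<in> I" "chain x S l (I - {y}) f" "t \<in> hits (I - {y}) S f" "q \<in> I - {y}"
      "f y = x - f t + f q \<or> f y = f t + f q - x" by auto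
    let ?g = "restrict f (I - {y})"
    have "?g \<in> C y" unfolding C_def
      using f y(2) card_hits_restrict[of I y S f] Suc.prems by (auto simp: chain_restrict)
    moreover have "t \<in> hits (I - {y}) S ?g" "?g t = f t" "?g q = f q" using y by (auto simp: hits_def)
    then have "f y \<in> R y ?g" unfolding R_def using y(4,5) by force
    ultimately show "\<exists>y\<in>I. restrict f (I - {y}) \<in> C y \<and> f y \<in> R y (restrict f (I - {y}))"
      using y(1) by blast
  next
    fix y g assume y: "y \<in> I" and g: "g \<in> C y"
    let ?P = "hits (I - {y}) S g \<times> (I - {y})"
    have fin: "finite ?P" using Suc.prems by auto
    have "card ?P = card (hits (I - {y}) S g) * card (I - {y})" by (rule card_cartesian_product)
    also have "\<dots> \<le> Q * k"
      using g Suc.prems card_Diff1_le[of I y] by (intro mult_mono) (auto simp: C_def)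
    finally have "card ?P \<le> Q * k" .
    moreover have "card (R y g) \<le> card ?P + card ?P" unfolding R_def
      by (rule order_trans[OF card_Un_le]) (intro add_mono card_image_le fin)
    ultimately show "finite (R y g) \<and> card (R y g) \<le> 2 * Q * k" using fin by (simp add: R_def)
  qed (use Suc.prems in \<open>auto simp: C_def\<close>)
  then have "card ?Bad * n ^ Suc l \<le> (\<Sum>y\<in>I. card (C y)) * (2 * Q * k) * n ^ Suc l"
    by (intro mult_le_mono1) blast
  also have "\<dots> = (\<Sum>y\<in>I. card (C y) * n ^ l) * n * (2 * Q * k)"
    by (simp add: sum_distrib_right[symmetric])
  also have "(\<Sum>y\<in>I. card (C y) * n ^ l) \<le> (\<Sum>y\<in>I. (2 * Q * k\<^sup>2) ^ l * n ^ (card I - 1))"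
  proof (rule sum_mono)
    fix y assume y: "y \<in> I"
    then have c: "card (I - {y}) = card I - 1" using Suc.prems by simp
    have "card (C y) * n ^ l \<le> (2 * Q * k\<^sup>2) ^ l * n ^ card (I - {y})"
      unfolding C_def by (rule Suc.IH) (use Suc.prems c in auto)
    then show "card (C y) * n ^ l \<le> (2 * Q * k\<^sup>2) ^ l * n ^ (card I - 1)" unfolding c .
  qed
  also have "\<dots> = card I * ((2 * Q * k\<^sup>2) ^ l * n ^ (card I - 1))" by simp
  finally have "card ?Bad * n ^ Suc l \<le> card I * ((2 * Q * k\<^sup>2) ^ l * n ^ (card I - 1)) * n * (2 * Q * k)"
    by (simp add: mult_right_mono)
  also have "\<dots> \<le> (2 * Q * k\<^sup>2) ^ Suc l * n ^ card I"
  proof (cases "card I")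
    case (Suc m)
    have "card I * ((2 * Q * k\<^sup>2) ^ l * n ^ (card I - 1)) * n * (2 * Q * k)
      = card I * ((2 * Q * k\<^sup>2) ^ l * (n ^ (card I - 1) * n) * (2 * Q * k))" by (simp only: ac_simps)
    also have "n ^ (card I - 1) * n = n ^ card I" using Suc by simp
    also have "card I * ((2 * Q * k\<^sup>2) ^ l * n ^ card I * (2 * Q * k))
      \<le> k * ((2 * Q * k\<^sup>2) ^ l * n ^ card I * (2 * Q * k))"
      using Suc.prems by (intro mult_le_mono1) auto
    finally show ?thesis by (simp add: power2_eq_square algebra_simps)
  qed simp
  finally show ?case .
qed

text \<open>Markov's inequality, applied to the number of hits.\<close>

lemma card_many_hits:
  assumes "S \<subseteq> {0..<int n}"
  shows "(Q + 1) * card {f \<in> {..<k} \<rightarrow>\<^sub>E {0..<int n}. \<not> card (hits {..<k} S f) \<le> Q} \<le> k * n ^ (k - 1) * card S"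
proof -
  let ?F = "{..<k} \<rightarrow>\<^sub>E {0..<int n}"
  let ?B = "{f \<in> ?F. \<not> card (hits {..<k} S f) \<le> Q}"
  have fS: "finite S" using assms finite_subset by blast
  have "(Q + 1) * card ?B = (\<Sum>f\<in>?B. Q + 1)" by simp
  also have "\<dots> \<le> (\<Sum>f\<in>?B. card (hits {..<k} S f))" by (intro sum_mono) auto
  also have "\<dots> \<le> (\<Sum>f\<in>?F. card (hits {..<k} S f))" by (intro sum_mono2) auto
  also have "\<dots> = (\<Sum>f\<in>?F. \<Sum>i<k. if f i \<in> S then 1 else 0)"
    by (simp add: hits_def sum.If_cases Int_def)
  also have "\<dots> = (\<Sum>i<k. \<Sum>f\<in>?F. if f i \<in> S then 1 else 0)" by (rule sum.swap)
  also have "\<dots> = (\<Sum>i<k. card {f \<in> ?F. f i \<in> S})" by (simp add: sum.If_cases Int_def)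
  also have "\<dots> = (\<Sum>i<k. n ^ (k - 1) * card S)"
  proof (rule sum.cong[OF refl])
    fix i assume i: "i \<in> {..<k}"
    have "{f \<in> ?F. f i \<in> S} = (\<Pi>\<^sub>E j\<in>{..<k}. if j = i then S else {0..<int n})"
    proof (rule set_eqI)
      fix f
      have "(\<forall>j\<in>{..<k}. f j \<in> (if j = i then S else {0..<int n})) \<longleftrightarrow>
          (\<forall>j\<in>{..<k}. f j \<in> {0..<int n}) \<and> f i \<in> S"
        using assms i by (metis subsetD)
      then show "f \<in> {f \<in> ?F. f i \<in> S} \<longleftrightarrow> f \<in> (\<Pi>\<^sub>E j\<in>{..<k}. if j = i then S else {0..<int n})"
        unfolding PiE_iff mem_Collect_eq by blast
    qed
    then have "card {f \<in> ?F. f i \<in> S} = (\<Prod>j<k. if j = i then card S else n)"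
      by (simp add: card_PiE if_distrib cong: if_cong)
    also have "\<dots> = card S * n ^ (k - 1)"
      using i by (simp add: prod.remove[of _ i] card_Diff_singleton)
    finally show "card {f \<in> ?F. f i \<in> S} = n ^ (k - 1) * card S" by simp
  qed
  finally show ?thesis by simp
qed

lemma card_avoid:
  assumes "S \<subseteq> {0..<int n}"
  shows "card {f \<in> {..<k} \<rightarrow>\<^sub>E {0..<int n}. \<forall>i<k. f i \<notin> S} = (n - card S) ^ k"
proof -
  have "{f \<in> {..<k} \<rightarrow>\<^sub>E {0..<int n}. \<forall>i<k. f i \<notin> S} = {..<k} \<rightarrow>\<^sub>E ({0..<int n} - S)"
    by (rule set_eqI) (simp only: mem_Collect_eq PiE_iff Diff_iff lessThan_iff Ball_def, blast)
  moreover have "card ({0..<int n} - S) = n - card S"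
    using assms finite_subset[OF assms] by (simp add: card_Diff_subset)
  ultimately show ?thesis by (simp add: card_PiE)
qed

text \<open>Links are found greedily, with \<open>J\<close> the indices used so far. A link adds at
  most three indices, so \<open>card J \<le> 3 * l\<close>, and the values of \<open>e\<close> that
  yield no fresh index are at most quadratic in \<open>card J\<close>. This gives the size demanded
  of \<open>E\<close>.\<close>

lemma chain_exists:
  assumes E: "E \<subseteq> f ` hits I S f" "(3 * l)\<^sup>2 + 6 * l + 1 < card E"
    and rel: "\<And>e. e \<in> E \<Longrightarrow> e \<noteq> x \<Longrightarrow> \<exists>p\<in>I. \<exists>q\<in>I. f p \<noteq> x \<and> f q \<noteq> x \<and> x = e + f p - f q"
  shows "chain x S l I f"
proof -
  have "\<exists>J\<subseteq>I. finite J \<and> card J \<le> 3 * j \<and> chain x S j J f" if "j \<le> l" for j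
    using that
  proof (induction j)
    case (Suc j)
    then obtain J where J: "J \<subseteq> I" "finite J" "card J \<le> 3 * j" "chain x S j J f" by auto
    \<comment> \<open>Values of \<open>e\<close> to avoid: \<open>x\<close> itself, values already
      used, those with both \<open>p\<close> and \<open>q\<close> in \<open>J\<close>, and those
      where \<open>p\<close> is the index of \<open>e\<close> and \<open>q\<close> lies in
      \<open>J\<close>, so that \<open>x = 2 * e - f q\<close>.\<close>
    define Bad where "Bad = insert x (f ` J \<union> (\<lambda>(p, q). x - f p + f q) ` (J \<times> J) \<union> (\<lambda>q. (x + f q) div 2) ` J)"
    have "card Bad \<le> Suc (card (f ` J \<union> (\<lambda>(p, q). x - f p + f q) ` (J \<times> J) \<union> (\<lambda>q. (x + f q) div 2) ` J))"
      unfolding Bad_def by (rule card_insert_le_m1) auto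
    also have "\<dots> \<le> Suc (card (f ` J) + card ((\<lambda>(p, q). x - f p + f q) ` (J \<times> J)) + card ((\<lambda>q. (x + f q) div 2) ` J))"
      by (meson Suc_le_mono add_le_mono1 card_Un_le le_trans)
    also have "\<dots> \<le> Suc (card J + card (J \<times> J) + card J)"
      using J(2) by (intro Suc_leI le_imp_less_Suc add_mono card_image_le) auto
    also have "\<dots> = (card J)\<^sup>2 + 2 * card J + 1" by (simp add: card_cartesian_product power2_eq_square)
    also have "\<dots> \<le> (3 * l)\<^sup>2 + 2 * (3 * l) + 1"
      using J(3) Suc.prems by (intro add_mono power_mono mult_left_mono) auto
    also have "\<dots> < card E" using E(2) by simp
    finally have "card Bad < card E" .
    then have "\<not> E \<subseteq> Bad" using card_mono[of Bad E] J(2) by (auto simp: Bad_def)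
    then obtain e where e: "e \<in> E" "e \<notin> Bad" by blast
    then have "e \<noteq> x" by (auto simp: Bad_def)
    then obtain p q where pq: "p \<in> I" "q \<in> I" "f p \<noteq> x" "f q \<noteq> x" "x = e + f p - f q" using rel e(1) by blast
    obtain t where t: "t \<in> hits I S f" "e = f t" using e(1) E(1) by blast
    have tI: "t \<in> I" "f t \<in> S" using t(1) by (auto simp: hits_def)
    have "t \<notin> J" using e(2) t(2) by (auto simp: Bad_def)
    have "p \<noteq> q" using pq(5) \<open>e \<noteq> x\<close> by auto
    have "q \<noteq> t" using pq t(2) by auto
    have "p \<notin> J \<union> {t} \<or> q \<notin> J"
    proof (rule ccontr)
      assume *: "\<not> (p \<notin> J \<union> {t} \<or> q \<notin> J)"
      show False
      proof (cases "p = t")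
        case True
        then have "e = (x + f q) div 2" using pq(5) t(2) by simp
        with * e(2) show False by (auto simp: Bad_def)
      next
        case False
        then have "(p, q) \<in> J \<times> J" "e = (\<lambda>(p, q). x - f p + f q) (p, q)" using * pq(5) by auto
        then have "e \<in> Bad" unfolding Bad_def by blast
        with e(2) show False by simp
      qed
    qed
    then obtain y z where yz: "y \<in> I" "z \<in> I" "y \<notin> J" "y \<noteq> t" "y \<noteq> z" "f y = x - f t + f z \<or> f y = f t + f z - x"
    proof
      assume "p \<notin> J \<union> {t}"
      then show ?thesis using that[of p q] pq \<open>p \<noteq> q\<close> t(2) by auto
    next
      assume "q \<notin> J"
      then show ?thesis using that[of q p] pq \<open>p \<noteq> q\<close> \<open>q \<noteq> t\<close> t(2) by auto
    qed
    define J' where "J' = insert y (insert t (insert z J))"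
    have "chain x S j (J' - {y}) f" using J(4) by (rule chain_mono) (use yz in \<open>auto simp: J'_def\<close>)
    moreover have "t \<in> hits (J' - {y}) S f" "z \<in> J' - {y}" "y \<in> J'"
      using yz tI by (auto simp: J'_def hits_def)
    ultimately have "chain x S (Suc j) J' f" using yz(6) by auto
    moreover have "card J' \<le> Suc (Suc (Suc (card J)))"
      unfolding J'_def using J(2) by (simp add: card_insert_if)
    then have "card J' \<le> 3 * Suc j" using J(3) by simp
    moreover have "J' \<subseteq> I" "finite J'" using J yz tI by (auto simp: J'_def)
    ultimately show ?case by blast
  qed (auto intro: exI[of _ "{}"])
  then obtain J where "J \<subseteq> I" "chain x S l J f" by blast
  then show ?thesis using chain_mono by blast
qed

section \<open>From functions to generic sets\<close>

text \<open>If \<open>p = q\<close> or both lie in \<open>S\<close>, padding produces a four-term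
  relation in the window. Otherwise the equation is solved for one of them outside \<open>S\<close>;
  its index automatically differs from those of the four window elements.\<close>

lemma no_mixed_relation:
  assumes four: "\<not> additive_coincidence 4 (f ` I \<inter> S)" and mixed: "\<not> mixed_coincidence S I f"
    and e: "{e1, e2, e3, e4} \<subseteq> f ` I \<inter> S" and pq: "p \<in> f ` I" "q \<in> f ` I"
    and eq: "e1 + e2 + p = e3 + e4 + q"
  shows "{e1, e2} \<inter> {e3, e4} \<noteq> {}"
proof
  assume disj: "{e1, e2} \<inter> {e3, e4} = {}"
  have mset: "mset xs = mset ys" if "length xs = 4" "length ys = 4" "set xs \<subseteq> f ` I \<inter> S" "set ys \<subseteq> f ` I \<inter> S"
      "sum_list xs = sum_list ys" for xs ys
    using four that unfolding additive_coincidence_def by blast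
  have contra: False if "y \<in> I" "f y = z" "z' \<in> f ` I" "z \<notin> S" "z \<noteq> z'" "{d1, d2, d3, d4} \<subseteq> f ` I \<inter> S"
      "z = d1 + d2 - d3 - d4 + z'" for y z z' d1 d2 d3 d4
  proof -
    have "\<exists>a\<in>hits (I - {y}) S f. f a = d" if "d \<in> {d1, d2, d3, d4}" for d
      using that \<open>{d1, d2, d3, d4} \<subseteq> f ` I \<inter> S\<close> \<open>z \<notin> S\<close> \<open>f y = z\<close> unfolding hits_def by blast
    then obtain a b c d where "a \<in> hits (I - {y}) S f" "f a = d1" "b \<in> hits (I - {y}) S f" "f b = d2"
        "c \<in> hits (I - {y}) S f" "f c = d3" "d \<in> hits (I - {y}) S f" "f d = d4" by (metis insertCI)
    moreover obtain w where "w \<in> I - {y}" "f w = z'"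
      using \<open>z' \<in> f ` I\<close> \<open>z \<noteq> z'\<close> \<open>f y = z\<close> by blast
    ultimately have "mixed_coincidence S I f" unfolding mixed_coincidence_def
      using \<open>y \<in> I\<close> \<open>f y = z\<close> \<open>z = d1 + d2 - d3 - d4 + z'\<close> by blast
    with mixed show False by blast
  qed
  consider "p = q" | "p \<in> S" "q \<in> S" | "p \<noteq> q" "p \<notin> S" | "p \<noteq> q" "q \<notin> S" by blast
  then show False
  proof cases
    case 1
    \<comment> \<open>Any window element could serve as padding; with \<open>e1\<close> the
      multiplicities of \<open>e1\<close> already disagree.\<close>
    have "mset [e1, e2, e1, e1] = mset [e3, e4, e1, e1]" by (rule mset) (use e eq 1 in auto)
    then have "count (mset [e1, e2, e1, e1]) e1 = count (mset [e3, e4, e1, e1]) e1" by (rule arg_cong)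
    with disj show False by (auto split: if_splits)
  next
    case 2
    have "mset [e1, e2, p, p] = mset [e3, e4, q, p]" by (rule mset) (use e eq 2 pq in auto)
    then have c: "count (mset [e1, e2, p, p]) z = count (mset [e3, e4, q, p]) z" for z by (rule arg_cong)
    from c[of e1] c[of e2] disj show False by (auto split: if_splits)
  next
    case 3
    obtain y where y: "y \<in> I" "f y = p" using pq by blast
    show False by (rule contra[OF y pq(2) 3(2,1), of e3 e4 e1 e2]) (use e eq in auto)
  next
    case 4
    obtain y where y: "y \<in> I" "f y = q" using pq by blast
    show False by (rule contra[OF y pq(1) 4(2), of e1 e2 e3 e4]) (use e eq 4 in auto)
  qed
qed

text \<open>The translation moves the minimum to 0. The end elements depend on \<open>f\<close>, but
  \<open>ends\<close> places them in the fixed window, where the absence of relations is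
  known.\<close>

lemma generic_of_sample:
  fixes f :: "nat \<Rightarrow> int" and I :: "nat set"
  defines "V \<equiv> f ` I"
  assumes I: "finite I" "I \<noteq> {}" "f ` I \<subseteq> {0..<int n}" "Min V < Max V" and r: "0 < r"
    and four: "\<not> additive_coincidence 4 (V \<inter> S)" and mixed: "\<not> mixed_coincidence S I f"
    and ends: "{v \<in> V. v - Min V < r \<or> Max V - v < r} \<subseteq> S"
    and sep: "Max V - Min V < r \<or> ((3 * l)\<^sup>2 + 6 * l + 1 < card {v \<in> V. v - Min V < r \<or> Max V - v < r} \<and>
      (\<forall>x\<in>{0..<int n}. \<not> chain x S l I f))"
  shows "generic_set ((\<lambda>v. v - Min V) ` V) (Max V - Min V) r"
proof -
  define \<alpha> \<beta> where "\<alpha> = Min V" and "\<beta> = Max V"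
  define E where "E = {v \<in> V. v - \<alpha> < r \<or> \<beta> - v < r}"
  have V: "finite V" "V \<noteq> {}" using I by (auto simp: V_def)
  have mem: "\<alpha> \<in> V" "\<beta> \<in> V" and bd: "\<And>v. v \<in> V \<Longrightarrow> \<alpha> \<le> v \<and> v \<le> \<beta>"
    using V by (auto simp: \<alpha>_def \<beta>_def)
  have memV: "v \<in> (\<lambda>v. v - \<alpha>) ` V \<longleftrightarrow> v + \<alpha> \<in> V" for v by force
  have memE: "v \<in> {v \<in> (\<lambda>v. v - \<alpha>) ` V. v < r \<or> \<beta> - \<alpha> - v < r} \<longleftrightarrow> v + \<alpha> \<in> E" for v
    by (auto simp: memV E_def algebra_simps)
  have E: "E \<subseteq> V \<inter> S" using ends by (auto simp: E_def \<alpha>_def \<beta>_def)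
  have "generic_set ((\<lambda>v. v - \<alpha>) ` V) (\<beta> - \<alpha>) r"
  proof (unfold_locales, goal_cases)
    case (6 e1 e2 e3 e4 e5 e6 e7 e8)
    then have e: "{e1 + \<alpha>, e2 + \<alpha>, e3 + \<alpha>, e4 + \<alpha>, e5 + \<alpha>, e6 + \<alpha>, e7 + \<alpha>, e8 + \<alpha>} \<subseteq> V \<inter> S"
      using E unfolding insert_subset memE by blast
    have "mset [e1 + \<alpha>, e2 + \<alpha>, e3 + \<alpha>, e4 + \<alpha>] = mset [e5 + \<alpha>, e6 + \<alpha>, e7 + \<alpha>, e8 + \<alpha>]"
    proof (rule ccontr)
      assume *: "mset [e1 + \<alpha>, e2 + \<alpha>, e3 + \<alpha>, e4 + \<alpha>] \<noteq> mset [e5 + \<alpha>, e6 + \<alpha>, e7 + \<alpha>, e8 + \<alpha>]"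
      have "additive_coincidence 4 (V \<inter> S)" unfolding additive_coincidence_def
        by (rule exI[of _ "[e1 + \<alpha>, e2 + \<alpha>, e3 + \<alpha>, e4 + \<alpha>]"], rule exI[of _ "[e5 + \<alpha>, e6 + \<alpha>, e7 + \<alpha>, e8 + \<alpha>]"])
          (intro conjI *, use 6(2) e in auto)
      with four show False by blast
    qed
    then have "image_mset (\<lambda>v. v - \<alpha>) (mset [e1 + \<alpha>, e2 + \<alpha>, e3 + \<alpha>, e4 + \<alpha>])
      = image_mset (\<lambda>v. v - \<alpha>) (mset [e5 + \<alpha>, e6 + \<alpha>, e7 + \<alpha>, e8 + \<alpha>])" by (rule arg_cong)
    then show ?case by simp
  next
    case (7 e1 e2 e3 e4 p q)
    then have "{e1 + \<alpha>, e2 + \<alpha>, e3 + \<alpha>, e4 + \<alpha>} \<subseteq> V \<inter> S"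
      using E unfolding insert_subset memE by blast
    moreover have "p + \<alpha> \<in> V" "q + \<alpha> \<in> V" using 7(2,3) unfolding memV .
    moreover have "(e1 + \<alpha>) + (e2 + \<alpha>) + (p + \<alpha>) = (e3 + \<alpha>) + (e4 + \<alpha>) + (q + \<alpha>)" using 7(4) by simp
    ultimately have "{e1 + \<alpha>, e2 + \<alpha>} \<inter> {e3 + \<alpha>, e4 + \<alpha>} \<noteq> {}"
      using four mixed unfolding V_def by (intro no_mixed_relation)
    then show ?case by auto
  next
    case 8
    show ?case
    proof (cases "\<beta> - \<alpha> < r")
      case False
      then have sep': "(3 * l)\<^sup>2 + 6 * l + 1 < card E" "\<forall>x\<in>{0..<int n}. \<not> chain x S l I f"
        using sep by (auto simp: E_def \<alpha>_def \<beta>_def)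
      show ?thesis
      proof (intro disjI2 ballI)
        fix x assume x: "x \<in> {0..\<beta> - \<alpha>}"
        have "\<alpha> \<in> {0..<int n}" "\<beta> \<in> {0..<int n}" using mem I(3) by (auto simp: V_def)
        then have "x + \<alpha> \<in> {0..<int n}" using x by auto
        then have nc: "\<not> chain (x + \<alpha>) S l I f" using sep'(2) by blast
        have EI: "E \<subseteq> f ` hits I S f" using E by (auto simp: V_def hits_def)
        have "\<exists>e\<in>E. e \<noteq> x + \<alpha> \<and> \<not> (\<exists>p\<in>I. \<exists>q\<in>I. f p \<noteq> x + \<alpha> \<and> f q \<noteq> x + \<alpha> \<and> x + \<alpha> = e + f p - f q)"
          using chain_exists[OF EI sep'(1), of "x + \<alpha>"] nc by blast
        then obtain e where e: "e \<in> E" "e \<noteq> x + \<alpha>"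
          "\<And>p q. p \<in> V \<Longrightarrow> q \<in> V \<Longrightarrow> p \<noteq> x + \<alpha> \<Longrightarrow> q \<noteq> x + \<alpha> \<Longrightarrow> x + \<alpha> \<noteq> e + p - q"
          unfolding V_def by blast
        show "\<exists>e\<in>{v \<in> (\<lambda>v. v - \<alpha>) ` V. v < r \<or> \<beta> - \<alpha> - v < r} - {x}.
           \<forall>p\<in>(\<lambda>v. v - \<alpha>) ` V - {x}. \<forall>q\<in>(\<lambda>v. v - \<alpha>) ` V - {x}. x \<noteq> e + p - q"
        proof (intro bexI[of _ "e - \<alpha>"] ballI)
          fix p q assume "p \<in> (\<lambda>v. v - \<alpha>) ` V - {x}" "q \<in> (\<lambda>v. v - \<alpha>) ` V - {x}"
          then have "x + \<alpha> \<noteq> e + (p + \<alpha>) - (q + \<alpha>)" by (intro e(3)) (auto simp: memV)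
          then show "x \<noteq> e - \<alpha> + p - q" by auto
        next
          show "e - \<alpha> \<in> {v \<in> (\<lambda>v. v - \<alpha>) ` V. v < r \<or> \<beta> - \<alpha> - v < r} - {x}"
            using e(1,2) memE[of "e - \<alpha>"] by auto
        qed
      qed
    qed simp
  qed (use mem bd I(4) r in \<open>auto simp: memV \<alpha>_def[symmetric] \<beta>_def[symmetric]\<close>)
  then show ?thesis by (simp add: \<alpha>_def \<beta>_def)
qed

section \<open>Random subsets\<close>

definition recovered :: "nat \<Rightarrow> nat \<Rightarrow> int set \<Rightarrow> bool" where
  "recovered n k V \<longleftrightarrow> uniquely_recoverable V \<and>
     (\<exists>X. outputs recover (input_memory n k (dist_set V)) X \<and> shift_reflect V X)"

lemma dist_set_empty_iff [simp]: "dist_set V = {} \<longleftrightarrow> V = {}"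
  unfolding dist_set_def by blast

lemma dist_set_nonneg: "w \<in> dist_set V \<Longrightarrow> 0 \<le> w"
  unfolding dist_set_def by auto

lemma dist_set_eq_image: "dist_set V = (\<lambda>(a, b). \<bar>a - b\<bar>) ` (V \<times> V)"
  unfolding dist_set_def by auto

lemma finite_dist_set: "finite V \<Longrightarrow> finite (dist_set V)"
  unfolding dist_set_eq_image by simp

text \<open>Uniqueness quantifies over arbitrary sets of integers, so the finiteness of a competitor
  has to come from its distances to one fixed element.\<close>

lemma finite_of_finite_dist_set:
  assumes "finite (dist_set V)"
  shows "finite V"
proof (cases "V = {}")
  case False
  then obtain u where u: "u \<in> V" by blast
  have "V \<subseteq> (\<lambda>w. u + w) ` dist_set V \<union> (\<lambda>w. u - w) ` dist_set V"
  proof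
    fix v assume v: "v \<in> V"
    then have *: "\<bar>v - u\<bar> \<in> dist_set V" using u unfolding abs_mem_dist_set by blast
    have "v = u + \<bar>v - u\<bar> \<or> v = u - \<bar>v - u\<bar>" by auto
    with * show "v \<in> (\<lambda>w. u + w) ` dist_set V \<union> (\<lambda>w. u - w) ` dist_set V" by blast
  qed
  then show ?thesis using assms finite_subset by blast
qed simp

lemma Max_dist_set:
  assumes "finite V" "V \<noteq> {}"
  shows "Max (dist_set V) = Max V - Min V"
proof (rule Max_eqI)
  have "Max V \<in> V" "Min V \<in> V" using assms by auto
  moreover have "Max V - Min V = \<bar>Max V - Min V\<bar>" using assms by simp
  ultimately show "Max V - Min V \<in> dist_set V" unfolding dist_set_def by blast
  fix w assume "w \<in> dist_set V"
  then obtain a b where "a \<in> V" "b \<in> V" "w = \<bar>a - b\<bar>" unfolding dist_set_def by blast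
  moreover from this have "a \<le> Max V" "b \<le> Max V" "Min V \<le> a" "Min V \<le> b" using assms by auto
  ultimately show "w \<le> Max V - Min V" by auto
qed (use assms finite_dist_set in blast)

lemma outputs_recover:
  assumes "finite W" "W \<subseteq> {0..int n}"
  shows "outputs recover (input_memory n k W) (max_scan W)"
  using runs_recover[OF assms] unfolding runs_def outputs_def by blast

lemma halts_recover:
  assumes "finite W" "W \<subseteq> {0..int n}"
  shows "halts_within recover (input_memory n k W) (20 * n * n + 45 * n + 20)"
  using runs_recover[OF assms] unfolding runs_def halts_within_def by blast

lemma dist_set_bounds:
  assumes "V \<subseteq> {0..<int n}"
  shows "dist_set V \<subseteq> {0..int n}"
proof
  fix w assume "w \<in> dist_set V"
  then obtain a b where "a \<in> V" "b \<in> V" "w = \<bar>a - b\<bar>" unfolding dist_set_def by blast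
  moreover from this have "a \<in> {0..<int n}" "b \<in> {0..<int n}" using assms by blast+
  ultimately show "w \<in> {0..int n}" by auto
qed

lemma recovered_trivial:
  assumes "finite V" "V \<subseteq> {0..<int n}" "Max V \<le> Min V \<or> V = {}"
  shows "recovered n k V"
proof (cases "V = {}")
  case True
  then show ?thesis using outputs_recover[of "{}" n k]
    by (auto simp: recovered_def uniquely_recoverable_def shift_reflect_def max_scan_def dist_set_def)
next
  case False
  define a where "a = Min V"
  have "v = a" if "v \<in> V" for v
    using that assms(1,3) False unfolding a_def by (metis Max_ge Min_le dual_order.antisym dual_order.trans)
  then have V: "V = {a}" using False by blast
  have W: "dist_set V = {0}" by (auto simp: V dist_set_def)
  have "shift_reflect V U" if U: "dist_set U = dist_set V" for U
  proof -
    have "U \<noteq> {}" using U V by (metis dist_set_empty_iff insert_not_empty)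
    then obtain u where u: "u \<in> U" by blast
    have "v = u" if "v \<in> U" for v
    proof -
      have "\<bar>v - u\<bar> \<in> dist_set U" using u that unfolding abs_mem_dist_set by blast
      then show ?thesis unfolding U W by simp
    qed
    then have "U = {u}" using u by blast
    then have "U = (\<lambda>v. (u - a) + v) ` V" by (simp add: V)
    then show ?thesis unfolding shift_reflect_def by blast
  qed
  moreover have "outputs recover (input_memory n k (dist_set V)) {0}"
    using outputs_recover[of "{0}" n k] by (simp add: W max_scan_def)
  moreover have "shift_reflect V {0}"
    unfolding shift_reflect_def by (rule exI[of _ "- a"]) (simp add: V)
  ultimately show ?thesis unfolding recovered_def uniquely_recoverable_def by blast
qed

lemma recovered_of_generic:
  assumes V: "finite V" "V \<noteq> {}" "V \<subseteq> {0..<int n}"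
    and gen: "generic_set ((\<lambda>v. v - Min V) ` V) (Max V - Min V) r"
  shows "recovered n k V"
proof -
  define \<alpha> M where "\<alpha> = Min V" and "M = Max V - Min V"
  define V0 where "V0 = (\<lambda>v. v - \<alpha>) ` V"
  interpret generic_set V0 M r "{v \<in> V0. v < r \<or> M - v < r}"
    using gen unfolding V0_def \<alpha>_def M_def .
  have V0: "V0 = (\<lambda>v. - \<alpha> + v) ` V" unfolding V0_def by simp
  then have dV0: "dist_set V0 = dist_set V" using dist_set_shift[of "- \<alpha>" V] by (simp only:)
  have refl: "(\<lambda>v. M - v) ` V0 = (\<lambda>v. (M + \<alpha>) - v) ` V" unfolding V0_def image_image by (simp add: algebra_simps)
  have "shift_reflect V U" if U: "dist_set U = dist_set V" for U
  proof -
    have fU: "finite U" using finite_of_finite_dist_set U finite_dist_set[OF V(1)] by simp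
    have neU: "U \<noteq> {}" using U V(2) by (metis dist_set_empty_iff)
    have MU: "Max U - Min U = M" using Max_dist_set[OF fU neU] Max_dist_set[OF V(1,2)] U by (simp add: M_def)
    have mU: "Min U \<in> U" "Max U \<in> U" "\<And>u. u \<in> U \<Longrightarrow> Min U \<le> u \<and> u \<le> Max U" using fU neU by auto
    define U0 where "U0 = (\<lambda>u. - Min U + u) ` U"
    have "U0 = V0 \<or> U0 = (\<lambda>v. M - v) ` V0"
    proof (rule unique)
      show "dist_set U0 = dist_set V0" unfolding U0_def dist_set_shift U dV0 ..
      show "U0 \<subseteq> {0..M}" unfolding U0_def using mU(3) by (auto simp: MU[symmetric])
      show "0 \<in> U0" unfolding U0_def by (rule image_eqI[OF _ mU(1)]) simp
      show "M \<in> U0" unfolding U0_def by (rule image_eqI[OF _ mU(2)]) (simp add: MU[symmetric])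
    qed
    moreover have "U = (\<lambda>u. Min U + u) ` U0" by (simp add: U0_def image_image)
    ultimately have "U = (\<lambda>u. Min U + u) ` V0 \<or> U = (\<lambda>u. Min U + u) ` (\<lambda>v. M - v) ` V0" by blast
    then have "U = (\<lambda>v. (Min U - \<alpha>) + v) ` V \<or> U = (\<lambda>v. (Min U + M + \<alpha>) - v) ` V"
      unfolding refl unfolding V0 image_image by (simp add: algebra_simps)
    then show ?thesis unfolding shift_reflect_def by blast
  qed
  moreover have "outputs recover (input_memory n k (dist_set V)) (max_scan (dist_set V))"
    by (rule outputs_recover[OF finite_dist_set[OF V(1)] dist_set_bounds[OF V(3)]])
  moreover have "max_scan (dist_set V) = greedy (dist_set V0) M (nat M - 1)"
    using Max_dist_set[OF V(1,2)] V(2) by (simp add: max_scan_def dV0 M_def)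
  then have "shift_reflect V (max_scan (dist_set V))"
    using greedy_correct unfolding refl unfolding V0 shift_reflect_def by metis
  ultimately show ?thesis unfolding recovered_def uniquely_recoverable_def by blast
qed

lemma card_inj_image:
  assumes "finite V" "card V = k"
  shows "card {f \<in> {..<k} \<rightarrow>\<^sub>E V. inj_on f {..<k}} = fact k"
  using card_inj_on_subset_funcset[of "{..<k}" V "{..<k}"] assms
  by (simp add: fact_prod_rev)

text \<open>Every \<open>k\<close>-set is the image of exactly \<open>k!\<close> injective
  functions. Dividing by all \<open>n ^ k\<close> functions instead of the injective ones can only
  lower the quotient, so non-injective functions count as failures.\<close>

lemma prob_random_subset:
  assumes "k \<le> n"
  shows "measure_pmf.prob (random_subset n k) {V. P V}
    \<ge> real (card {f \<in> {..<k} \<rightarrow>\<^sub>E {0..<int n}. inj_on f {..<k} \<and> P (f ` {..<k})}) / real n ^ k"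
proof -
  define S where "S = {V. V \<subseteq> {0..<int n} \<and> card V = k}"
  have fin: "finite S" unfolding S_def by (rule finite_subset[of _ "Pow {0..<int n}"]) auto
  have cS: "card S = n choose k" unfolding S_def using n_subsets[of "{0..<int n}" k] by simp
  then have "S \<noteq> {}" using assms by (metis card.empty binomial_eq_0_iff not_le)
  have finV: "finite V" if "V \<in> S" for V using that finite_subset unfolding S_def by blast
  define F where "F = (\<lambda>V :: int set. {f \<in> {..<k} \<rightarrow>\<^sub>E V. inj_on f {..<k}})"
  have img: "f ` {..<k} = V" if "V \<in> S" "f \<in> F V" for V f
  proof (rule card_subset_eq)
    show "finite V" using finV that by blast
    show "f ` {..<k} \<subseteq> V" using that(2) by (auto simp: F_def)
    show "card (f ` {..<k}) = card V" using that by (auto simp: F_def S_def card_image)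
  qed
  have count: "card {f \<in> {..<k} \<rightarrow>\<^sub>E {0..<int n}. inj_on f {..<k} \<and> R (f ` {..<k})} = card {V \<in> S. R V} * fact k" for R
  proof -
    have "{f \<in> {..<k} \<rightarrow>\<^sub>E {0..<int n}. inj_on f {..<k} \<and> R (f ` {..<k})} = (\<Union>V\<in>{V \<in> S. R V}. F V)"
    proof (intro equalityI subsetI)
      fix f assume f: "f \<in> {f \<in> {..<k} \<rightarrow>\<^sub>E {0..<int n}. inj_on f {..<k} \<and> R (f ` {..<k})}"
      then have "f ` {..<k} \<in> {V \<in> S. R V}" by (auto simp: S_def card_image)
      moreover have "f \<in> F (f ` {..<k})" using f by (auto simp: F_def PiE_iff)
      ultimately show "f \<in> (\<Union>V\<in>{V \<in> S. R V}. F V)" by blast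
    next
      fix f assume "f \<in> (\<Union>V\<in>{V \<in> S. R V}. F V)"
      then obtain V where V: "V \<in> S" "R V" "f \<in> F V" by blast
      moreover have "f ` {..<k} = V" using img V by blast
      ultimately show "f \<in> {f \<in> {..<k} \<rightarrow>\<^sub>E {0..<int n}. inj_on f {..<k} \<and> R (f ` {..<k})}"
        by (auto simp: F_def S_def PiE_iff)
    qed
    also have "card \<dots> = (\<Sum>V\<in>{V \<in> S. R V}. card (F V))"
    proof (rule card_UN_disjoint)
      show "\<forall>V\<in>{V \<in> S. R V}. finite (F V)" using finV by (auto simp: F_def finite_PiE)
      show "\<forall>V\<in>{V \<in> S. R V}. \<forall>V'\<in>{V \<in> S. R V}. V \<noteq> V' \<longrightarrow> F V \<inter> F V' = {}" using img by blast
    qed (use fin in auto)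
    also have "\<dots> = (\<Sum>V\<in>{V \<in> S. R V}. fact k)"
    proof (rule sum.cong[OF refl])
      fix V assume "V \<in> {V \<in> S. R V}"
      then have "V \<in> S" by simp
      then have "finite V" "card V = k" using finV[of V] by (simp_all only: S_def mem_Collect_eq simp_thms)
      then show "card (F V) = fact k" unfolding F_def by (rule card_inj_image)
    qed
    finally show ?thesis by (simp only: sum_constant of_nat_id)
  qed
  have "card S * fact k \<le> n ^ k"
  proof -
    have "card S * fact k = card {f \<in> {..<k} \<rightarrow>\<^sub>E {0..<int n}. inj_on f {..<k}}" using count[of "\<lambda>_. True"] by simp
    also have "\<dots> \<le> card ({..<k} \<rightarrow>\<^sub>E {0..<int n})" by (intro card_mono) auto
    also have "\<dots> = n ^ k" by (simp add: card_funs)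
    finally show ?thesis .
  qed
  then have le: "real (card S) * fact k \<le> real n ^ k" by (metis of_nat_le_iff of_nat_mult of_nat_power of_nat_fact)
  have pos: "0 < card S" using \<open>S \<noteq> {}\<close> fin by (simp add: card_gt_0_iff)
  have "0 < real (card S) * fact k" using pos by simp
  then have pn: "0 < real n ^ k" using le by linarith
  have "real (card {f \<in> {..<k} \<rightarrow>\<^sub>E {0..<int n}. inj_on f {..<k} \<and> P (f ` {..<k})}) / real n ^ k
    = real (card {V \<in> S. P V}) * fact k / real n ^ k" by (simp add: count)
  also have "\<dots> \<le> real (card {V \<in> S. P V}) * fact k / (real (card S) * fact k)"
    using le pos pn by (intro divide_left_mono mult_pos_pos) auto
  also have "\<dots> = real (card {V \<in> S. P V}) / real (card S)" by simp
  also have "\<dots> = measure_pmf.prob (random_subset n k) {V. P V}"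
    unfolding random_subset_def S_def[symmetric] using measure_pmf_of_set[OF \<open>S \<noteq> {}\<close> fin]
    by (simp add: Int_def)
  finally show ?thesis .
qed

text \<open>The union bound over six failures, in the order of the terms: a repeated value, too many
  hits, a four-term relation (\<open>9 = 2 * 4 + 1\<close> coefficients and \<open>8 = 2 * 4\<close>
  entries), a mixed relation, a chain at one of \<open>n\<close> points, and
  \<open>Bad\<close>.\<close>

lemma prob_recovered:
  fixes n k l Q :: nat and S :: "int set" and r :: int
  defines "E \<equiv> \<lambda>V. {v \<in> V. v - Min V < r \<or> Max V - v < r}"
  assumes k: "0 < k" "k \<le> n" and S: "S \<subseteq> {0..<int n}" and r: "0 < r"
    and Bad: "Bad \<subseteq> {..<k} \<rightarrow>\<^sub>E {0..<int n}"
    and good: "\<And>f. f \<in> {..<k} \<rightarrow>\<^sub>E {0..<int n} \<Longrightarrow> f \<notin> Bad \<Longrightarrow> E (f ` {..<k}) \<subseteq> S \<and>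
      (Max (f ` {..<k}) - Min (f ` {..<k}) < r \<or> (3 * l)\<^sup>2 + 6 * l + 1 < card (E (f ` {..<k})))"
  shows "measure_pmf.prob (random_subset n k) {V. recovered n k V} \<ge>
    1 - (real k * real k / real n + real k * real (card S) / (real n * (real Q + 1))
      + 9 * real k * (real Q + 1) ^ 8 / real n + real k * real Q ^ 4 * real k / real n
      + real n * (2 * real Q * (real k)\<^sup>2 / real n) ^ l + real (card Bad) / real n ^ k)"
proof -
  let ?I = "{..<k}"
  let ?F = "?I \<rightarrow>\<^sub>E {0..<int n}"
  define G where "G = {f \<in> ?F. inj_on f ?I \<and> recovered n k (f ` ?I)}"
  define B1 where "B1 = {f \<in> ?F. \<not> inj_on f ?I}"
  define B2 where "B2 = {f \<in> ?F. \<not> card (hits ?I S f) \<le> Q}"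
  define B3 where "B3 = {f \<in> ?F. card (hits ?I S f) \<le> Q \<and> additive_coincidence 4 (f ` ?I \<inter> S)}"
  define B4 where "B4 = {f \<in> ?F. card (hits ?I S f) \<le> Q \<and> mixed_coincidence S ?I f}"
  define B5 where "B5 = (\<lambda>x. {f \<in> ?F. card (hits ?I S f) \<le> Q \<and> chain x S l ?I f})"
  have cover: "?F \<subseteq> G \<union> B1 \<union> B2 \<union> B3 \<union> B4 \<union> (\<Union>x\<in>{0..<int n}. B5 x) \<union> Bad"
  proof
    fix f assume f: "f \<in> ?F"
    show "f \<in> G \<union> B1 \<union> B2 \<union> B3 \<union> B4 \<union> (\<Union>x\<in>{0..<int n}. B5 x) \<union> Bad"
    proof (rule ccontr)
      assume "f \<notin> G \<union> B1 \<union> B2 \<union> B3 \<union> B4 \<union> (\<Union>x\<in>{0..<int n}. B5 x) \<union> Bad"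
      then have nB: "f \<notin> G" "f \<notin> B1" "f \<notin> B2" "f \<notin> B3" "f \<notin> B4" "f \<notin> Bad"
        and n5: "\<And>x. x \<in> {0..<int n} \<Longrightarrow> f \<notin> B5 x" by blast+
      have inj: "inj_on f ?I" using nB(2) f by (simp add: B1_def)
      have fw: "card (hits ?I S f) \<le> Q" using nB(3) f by (simp add: B2_def)
      let ?V = "f ` ?I"
      have sub: "?V \<subseteq> {0..<int n}" using f by (auto simp: PiE_iff)
      have V: "finite ?V" "?V \<noteq> {}" using k by (auto simp: lessThan_empty_iff)
      have "recovered n k ?V"
      proof (cases "Min ?V < Max ?V")
        case False
        then show ?thesis using recovered_trivial[OF V(1) sub] by simp
      next
        case True
        have "generic_set ((\<lambda>v. v - Min ?V) ` ?V) (Max ?V - Min ?V) r"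
        proof (rule generic_of_sample[where n = n and S = S and l = l])
          show "?I \<noteq> {}" using k by (simp add: lessThan_empty_iff)
          show "\<not> additive_coincidence 4 (?V \<inter> S)" using nB(4) f fw by (simp add: B3_def)
          show "\<not> mixed_coincidence S ?I f" using nB(5) f fw by (simp add: B4_def)
          have "\<not> chain x S l ?I f" if "x \<in> {0..<int n}" for x
            using n5[OF that] f fw by (simp add: B5_def)
          then show "Max ?V - Min ?V < r \<or> (3 * l)\<^sup>2 + 6 * l + 1 < card {v \<in> ?V. v - Min ?V < r \<or> Max ?V - v < r} \<and>
            (\<forall>x\<in>{0..<int n}. \<not> chain x S l ?I f)"
            using good[OF f nB(6)] unfolding E_def by blast
          show "{v \<in> ?V. v - Min ?V < r \<or> Max ?V - v < r} \<subseteq> S"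
            using good[OF f nB(6)] unfolding E_def by blast
        qed (use sub True r in auto)
        then show ?thesis using recovered_of_generic V sub by blast
      qed
      then show False using nB(1) f inj by (simp add: G_def)
    qed
  qed
  have finF: "finite ?F" by simp
  have fin: "finite G" "finite B1" "finite B2" "finite B3" "finite B4" "\<And>x. finite (B5 x)" "finite Bad"
    using finF finite_subset[OF Bad] by (simp_all add: G_def B1_def B2_def B3_def B4_def B5_def)
  have "n ^ k = card ?F" by (simp add: card_funs)
  also have "\<dots> \<le> card (G \<union> B1 \<union> B2 \<union> B3 \<union> B4 \<union> (\<Union>x\<in>{0..<int n}. B5 x) \<union> Bad)"
    using cover fin by (intro card_mono) auto
  also have "\<dots> \<le> card G + card B1 + card B2 + card B3 + card B4 + card (\<Union>x\<in>{0..<int n}. B5 x) + card Bad"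
    by (intro order_trans[OF card_Un_le] add_mono order_refl)
  finally have "real (n ^ k) \<le> real (card G + card B1 + card B2 + card B3 + card B4 + card (\<Union>x\<in>{0..<int n}. B5 x) + card Bad)"
    by (rule of_nat_mono)
  then have total: "real n ^ k \<le> real (card G) + real (card B1) + real (card B2) + real (card B3) + real (card B4)
      + real (card (\<Union>x\<in>{0..<int n}. B5 x)) + real (card Bad)" by simp
  define N where "N = real n ^ k"
  have n: "0 < real n" using k by simp
  have "N = real n * real n ^ (k - 1)" unfolding N_def using k(1) by (cases k) simp_all
  with n have N: "0 < N" "real k * real n ^ (k - 1) = N * (real k / real n)"
    by (simp_all add: N_def)
  have step: "real c \<le> N * (real k / real n * real B)" if "c \<le> k * n ^ (k - 1) * B" for c B
  proof -
    have "real c \<le> real (k * n ^ (k - 1) * B)" using that by (rule of_nat_mono)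
    also have "\<dots> = N * (real k / real n) * real B" unfolding N(2)[symmetric] by (simp only: of_nat_mult of_nat_power)
    finally show ?thesis by (simp add: mult.assoc)
  qed
  have b1: "real (card B1) \<le> N * (real k * real k / real n)"
    using step[OF card_not_inj[of k n]] by (simp add: B1_def)
  have "real ((Q + 1) * card B2) \<le> N * (real k / real n * real (card S))"
    unfolding B2_def by (rule step) (rule card_many_hits[OF S])
  then have "real (card B2) * (real Q + 1) \<le> N * (real k * real (card S) / real n)"
    by (simp add: algebra_simps)
  then have "real (card B2) \<le> N * (real k * real (card S) / real n) / (real Q + 1)"
    by (subst pos_le_divide_eq) auto
  then have b2: "real (card B2) \<le> N * (real k * real (card S) / (real n * (real Q + 1)))" by simp
  have b3: "real (card B3) \<le> N * (9 * real k * (real Q + 1) ^ 8 / real n)"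
    using step[OF card_additive_coincidence[of k n S Q 4]] by (simp add: B3_def add.commute mult.commute mult.left_commute)
  have "card B4 \<le> k * n ^ (k - 1) * (Q ^ 4 * k)"
    unfolding B4_def by (rule card_mixed_coincidence)
  from step[OF this] have b4: "real (card B4) \<le> N * (real k * real Q ^ 4 * real k / real n)"
    by (simp add: mult.assoc)
  have "real (card (B5 x)) \<le> N * (2 * real Q * (real k)\<^sup>2 / real n) ^ l" for x
  proof -
    have "card (B5 x) * n ^ l \<le> (2 * Q * k\<^sup>2) ^ l * n ^ k"
      using card_chain[of ?I k n S Q x l] by (simp add: B5_def)
    then have "real (card (B5 x) * n ^ l) \<le> real ((2 * Q * k\<^sup>2) ^ l * n ^ k)" by (rule of_nat_mono)
    then have "real (card (B5 x)) * real n ^ l \<le> (2 * real Q * (real k)\<^sup>2) ^ l * N" by (simp add: N_def)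
    then have "real (card (B5 x)) \<le> (2 * real Q * (real k)\<^sup>2) ^ l * N / real n ^ l"
      using n by (subst pos_le_divide_eq) auto
    then show ?thesis by (simp add: power_divide mult.commute)
  qed
  then have "(\<Sum>x\<in>{0..<int n}. real (card (B5 x))) \<le> (\<Sum>x\<in>{0..<int n}. N * (2 * real Q * (real k)\<^sup>2 / real n) ^ l)"
    by (intro sum_mono)
  also have "\<dots> = N * (real n * (2 * real Q * (real k)\<^sup>2 / real n) ^ l)" by simp
  finally have "(\<Sum>x\<in>{0..<int n}. real (card (B5 x))) \<le> N * (real n * (2 * real Q * (real k)\<^sup>2 / real n) ^ l)" .
  moreover have "real (card (\<Union>x\<in>{0..<int n}. B5 x)) \<le> real (\<Sum>x\<in>{0..<int n}. card (B5 x))"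
    by (intro of_nat_mono card_UN_le) simp
  ultimately have b5: "real (card (\<Union>x\<in>{0..<int n}. B5 x)) \<le> N * (real n * (2 * real Q * (real k)\<^sup>2 / real n) ^ l)"
    by simp
  have b6: "real (card Bad) = N * (real (card Bad) / real n ^ k)" using N(1) by (simp add: N_def)
  have "N * (1 - (real k * real k / real n + real k * real (card S) / (real n * (real Q + 1))
      + 9 * real k * (real Q + 1) ^ 8 / real n + real k * real Q ^ 4 * real k / real n
      + real n * (2 * real Q * (real k)\<^sup>2 / real n) ^ l + real (card Bad) / real n ^ k)) \<le> real (card G)"
    using total b1 b2 b3 b4 b5 b6 unfolding N_def[symmetric] by (simp only: distrib_left right_diff_distrib mult_1_right)
  then have "1 - (real k * real k / real n + real k * real (card S) / (real n * (real Q + 1))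
      + 9 * real k * (real Q + 1) ^ 8 / real n + real k * real Q ^ 4 * real k / real n
      + real n * (2 * real Q * (real k)\<^sup>2 / real n) ^ l + real (card Bad) / real n ^ k) \<le> real (card G) / N"
    using N(1) by (simp add: pos_le_divide_eq mult.commute)
  also have "\<dots> \<le> measure_pmf.prob (random_subset n k) {V. recovered n k V}"
    unfolding G_def N_def using prob_random_subset[OF k(2)] by blast
  finally show ?thesis .
qed

section \<open>Two regimes for the size of the subset\<close>

text \<open>The window is the whole range and \<open>r = n + 1\<close> exceeds every diameter, so
  each element is an end element and \<open>Bad\<close> is empty.\<close>

lemma prob_recovered_small:
  fixes n k l Q :: nat
  assumes k: "0 < k" "k \<le> n"
  shows "measure_pmf.prob (random_subset n k) {V. recovered n k V} \<ge>
    1 - (real k * real k / real n + real k / (real Q + 1)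
      + 9 * real k * (real Q + 1) ^ 8 / real n + real k * real Q ^ 4 * real k / real n
      + real n * (2 * real Q * (real k)\<^sup>2 / real n) ^ l)"
proof -
  have "f ` {..<k} \<subseteq> {0..<int n} \<and> Max (f ` {..<k}) - Min (f ` {..<k}) < int n + 1"
    if f: "f \<in> {..<k} \<rightarrow>\<^sub>E {0..<int n}" for f
  proof
    show *: "f ` {..<k} \<subseteq> {0..<int n}" using f by (auto simp: PiE_iff)
    have "Max (f ` {..<k}) \<in> f ` {..<k}" "Min (f ` {..<k}) \<in> f ` {..<k}"
      using k by (auto simp: lessThan_empty_iff intro!: Max_in Min_in)
    then have "Max (f ` {..<k}) \<in> {0..<int n}" "Min (f ` {..<k}) \<in> {0..<int n}" using * by blast+
    then show "Max (f ` {..<k}) - Min (f ` {..<k}) < int n + 1" by auto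
  qed
  then show ?thesis
    using prob_recovered[OF k, of "{0..<int n}" "int n + 1" "{}" l Q] k by (auto simp: subset_iff)
qed

lemma prob_recovered_large:
  fixes n k l Q b m :: nat
  assumes k: "0 < k" "k \<le> n" and b: "0 < b" "m * b \<le> n" and m: "(3 * l)\<^sup>2 + 6 * l + 1 < m"
  shows "measure_pmf.prob (random_subset n k) {V. recovered n k V} \<ge>
    1 - (real k * real k / real n + real k * real (4 * m * b) / (real n * (real Q + 1))
      + 9 * real k * (real Q + 1) ^ 8 / real n + real k * real Q ^ 4 * real k / real n
      + real n * (2 * real Q * (real k)\<^sup>2 / real n) ^ l + real (m + 1) * (1 - real b / real n) ^ k)"
proof -
  define r where "r = int (m * b)"
  \<comment> \<open>Outside \<open>Bad\<close> the extremes of \<open>V\<close> lie within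
    \<open>r\<close> of the ends of the range, so elements within \<open>r\<close> of an extreme lie
    within \<open>2 * r\<close>.\<close>
  define S where "S = ({0..<2 * r} \<union> {int n - 2 * r..<int n}) \<inter> {0..<int n}"
  let ?F = "{..<k} \<rightarrow>\<^sub>E {0..<int n}"
  define block where "block = (\<lambda>j. {int (j * b)..<int (j * b) + int b})"
  define avoid where "avoid = (\<lambda>T. {f \<in> ?F. \<forall>i<k. f i \<notin> T})"
  \<comment> \<open>The \<open>m\<close> blocks on the left supply \<open>m\<close> distinct end
    elements and locate the minimum; one block on the right locates the maximum.\<close>
  define Bad where "Bad = (\<Union>j\<in>{..<m}. avoid (block j)) \<union> avoid {int n - int b..<int n}"
  have m0: "0 < m" using m by simp
  have bm: "b \<le> m * b" using m0 by simp
  have block: "block j \<subseteq> {0..<r}" if "j < m" for j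
  proof -
    have "(j + 1) * b \<le> m * b" using that by (intro mult_le_mono1) simp
    then have "int (j * b) + int b \<le> r" unfolding r_def by (simp add: algebra_simps flip: of_nat_mult of_nat_add)
    then show ?thesis unfolding block_def by auto
  qed
  have rn: "r \<le> int n" "0 < r" "int b \<le> r" using b bm m0 unfolding r_def by (simp_all flip: of_nat_mult)
  have cav: "card (avoid T) = (n - b) ^ k" if "T \<subseteq> {0..<int n}" "card T = b" for T
    unfolding avoid_def using card_avoid[OF that(1)] that(2) by simp
  have "card Bad \<le> (\<Sum>j<m. card (avoid (block j))) + card (avoid {int n - int b..<int n})"
    unfolding Bad_def by (rule order_trans[OF card_Un_le]) (intro add_mono card_UN_le order_refl finite_lessThan)
  also have "\<dots> = (\<Sum>j<m. (n - b) ^ k) + (n - b) ^ k"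
  proof (intro arg_cong2[where f = "(+)"] sum.cong refl cav)
    fix j assume "j \<in> {..<m}"
    then show "block j \<subseteq> {0..<int n}" using block[of j] rn by auto
    show "card (block j) = b" by (simp add: block_def)
  qed (use rn in auto)
  finally have "real (card Bad) \<le> real ((m + 1) * (n - b) ^ k)" by (intro of_nat_mono) simp
  also have "\<dots> = real (m + 1) * (real n - real b) ^ k"
    using le_trans[OF bm b(2)] by (simp only: of_nat_mult of_nat_power of_nat_diff)
  finally have "real (card Bad) / real n ^ k \<le> real (m + 1) * (real n - real b) ^ k / real n ^ k"
    by (rule divide_right_mono) simp
  also have "\<dots> = real (m + 1) * (1 - real b / real n) ^ k"
  proof -
    have "1 - real b / real n = (real n - real b) / real n" using k by (simp add: diff_divide_distrib)
    then show ?thesis by (simp only: power_divide times_divide_eq_right)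
  qed
  finally have cBad: "real (card Bad) / real n ^ k \<le> real (m + 1) * (1 - real b / real n) ^ k" .
  have "card S \<le> card ({0..<2 * r} \<union> {int n - 2 * r..<int n})" unfolding S_def by (intro card_mono) auto
  also have "\<dots> \<le> card {0..<2 * r} + card {int n - 2 * r..<int n}" by (rule card_Un_le)
  also have "\<dots> = 4 * m * b" by (simp add: r_def nat_mult_distrib)
  finally have cS: "real (card S) \<le> real (4 * m * b)" by (rule of_nat_mono)
  have good: "{v \<in> V. v - Min V < r \<or> Max V - v < r} \<subseteq> S \<and>
      (Max V - Min V < r \<or> (3 * l)\<^sup>2 + 6 * l + 1 < card {v \<in> V. v - Min V < r \<or> Max V - v < r})"
    if f: "f \<in> ?F" "f \<notin> Bad" and V_def: "V = f ` {..<k}" for f V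
  proof -
    have V: "finite V" "V \<noteq> {}" "V \<subseteq> {0..<int n}" using k f(1) by (auto simp: V_def lessThan_empty_iff PiE_iff)
    have hit: "\<exists>v\<in>V. v \<in> block j" if "j < m" for j
      using f that unfolding Bad_def avoid_def V_def by blast
    have "\<exists>v\<in>V. v \<in> {int n - int b..<int n}" using f unfolding Bad_def avoid_def V_def by blast
    then obtain v1 where "v1 \<in> V" "int n - int b \<le> v1" by auto
    then have mx: "int n - r \<le> Max V" using Max_ge[OF V(1), of v1] rn(3) by linarith
    obtain v0 where "v0 \<in> V" "v0 \<in> block 0" using hit m0 by blast
    then have mn: "Min V < r" using Min_le[OF V(1), of v0] rn(3) by (simp add: block_def)
    have mn0: "0 \<le> Min V" using V Min_in[OF V(1,2)] by auto
    obtain g where g: "\<And>j. j < m \<Longrightarrow> g j \<in> V \<and> g j \<in> block j" using hit by metis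
    have "inj_on g {..<m}"
    proof (rule inj_onI)
      fix i j assume ij: "i \<in> {..<m}" "j \<in> {..<m}" "g i = g j"
      have less: False if "i < j" "x \<in> block i" "x \<in> block j" for i j x
      proof -
        have "(i + 1) * b \<le> j * b" using that(1) by (intro mult_le_mono1) simp
        then have "i * b + b \<le> j * b" by simp
        then have "int (i * b) + int b \<le> int (j * b)" by linarith
        then show False using that(2,3) by (auto simp: block_def)
      qed
      show "i = j" using less[of i j "g i"] less[of j i "g i"] g[of i] g[of j] ij by (cases i j rule: linorder_cases) auto
    qed
    moreover have "g ` {..<m} \<subseteq> {v \<in> V. v - Min V < r \<or> Max V - v < r}"
    proof
      fix v assume "v \<in> g ` {..<m}"
      then obtain j where j: "j < m" "v = g j" by blast
      then have "v \<in> {0..<r}" using g[OF j(1)] block[OF j(1)] by blast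
      then show "v \<in> {v \<in> V. v - Min V < r \<or> Max V - v < r}" using g[OF j(1)] j mn0 by auto
    qed
    ultimately have "m \<le> card {v \<in> V. v - Min V < r \<or> Max V - v < r}"
      using card_inj_on_le[of g "{..<m}" "{v \<in> V. v - Min V < r \<or> Max V - v < r}"] V(1) by simp
    moreover have "{v \<in> V. v - Min V < r \<or> Max V - v < r} \<subseteq> S"
      using V(3) mx mn unfolding S_def by auto
    ultimately show ?thesis using m by auto
  qed
  have "measure_pmf.prob (random_subset n k) {V. recovered n k V} \<ge>
    1 - (real k * real k / real n + real k * real (card S) / (real n * (real Q + 1))
      + 9 * real k * (real Q + 1) ^ 8 / real n + real k * real Q ^ 4 * real k / real n
      + real n * (2 * real Q * (real k)\<^sup>2 / real n) ^ l + real (card Bad) / real n ^ k)"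
    by (rule prob_recovered[OF k, of S r Bad])
      (use rn good[OF _ _ refl] in \<open>auto simp: S_def Bad_def avoid_def\<close>)
  moreover have "real k * real (card S) / (real n * (real Q + 1)) \<le> real k * real (4 * m * b) / (real n * (real Q + 1))"
    using cS by (intro divide_right_mono mult_left_mono) auto
  ultimately show ?thesis using cBad by linarith
qed

section \<open>Choice of parameters\<close>

text \<open>With \<open>h\<close> the power \<open>\<epsilon> / 8\<close> of \<open>n\<close> and
  \<open>Q\<close> about \<open>h^2\<close>, the factors \<open>Q^4\<close> and \<open>Q^8\<close>
  are the powers \<open>\<epsilon>\<close> and \<open>2 \<epsilon>\<close>, small enough for the
  mixed and four-term bounds. A chain link costs the power \<open>- 7/4 \<epsilon>\<close>, so
  \<open>l\<close> links outweigh the factor \<open>n\<close>.\<close>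

lemma prob_recovered_asymptotic:
  fixes \<epsilon> C :: real and n k l m :: nat
  defines "x \<equiv> real n"
  assumes \<epsilon>: "0 < \<epsilon>" "\<epsilon> \<le> 1 / 4" and l: "1 \<le> \<epsilon> * real l" and m: "(3 * l)\<^sup>2 + 6 * l + 1 < m"
    and n: "2 * m \<le> n" and k: "0 < k" "k \<le> n" "real k \<le> C * x powr (1 / 2 - \<epsilon>)"
  shows "measure_pmf.prob (random_subset n k) {V. recovered n k V} \<ge>
    1 - (C\<^sup>2 * x powr (- (2 * \<epsilon>)) + 8 * real m * x powr (- (\<epsilon> / 8)) + 2304 * C * x powr (- (1 / 4))
      + C\<^sup>2 * x powr (- \<epsilon>) + (2 * C\<^sup>2) ^ l * x powr (- (3 / 4)) + real (m + 1) * x powr (- (\<epsilon> / 8)))"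
proof -
  define h where "h = x powr (\<epsilon> / 8)"
  define Q where "Q = nat \<lfloor>h\<^sup>2\<rfloor>"
  have m0: "0 < m" using m by simp
  have x: "1 \<le> x" using n m0 unfolding x_def by linarith
  then have h1: "1 \<le> h" unfolding h_def using \<epsilon> by (intro ge_one_powr_ge_zero) auto
  then have h2: "1 \<le> h\<^sup>2" by simp
  have hp: "h ^ i = x powr (real i * (\<epsilon> / 8))" for i
    unfolding h_def using x by (simp add: powr_power)
  have hinv: "1 / h = x powr (- (\<epsilon> / 8))" unfolding h_def using x by (simp add: powr_minus_divide)
  have Q: "real Q \<le> h\<^sup>2" "h\<^sup>2 \<le> real Q + 1" "real Q + 1 \<le> 2 * h\<^sup>2"
    unfolding Q_def using h2 by linarith+
  have C0: "0 \<le> C"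
  proof (rule ccontr)
    assume "\<not> 0 \<le> C"
    then have "C * x powr (1 / 2 - \<epsilon>) \<le> 0" by (intro mult_nonpos_nonneg) auto
    with k show False by simp
  qed
  have kk: "(real k)\<^sup>2 \<le> C\<^sup>2 * x powr (1 - 2 * \<epsilon>)"
  proof -
    have "(real k)\<^sup>2 \<le> (C * x powr (1 / 2 - \<epsilon>))\<^sup>2" using k(3) by (intro power_mono) auto
    also have "\<dots> = C\<^sup>2 * x powr (1 - 2 * \<epsilon>)"
      using x by (simp add: power_mult_distrib powr_power algebra_simps)
    finally show ?thesis .
  qed
  have kkx: "(real k)\<^sup>2 / x \<le> C\<^sup>2 * x powr (- (2 * \<epsilon>))"
  proof -
    have "(real k)\<^sup>2 / x \<le> C\<^sup>2 * x powr (1 - 2 * \<epsilon>) / x powr 1"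
      using kk x by (simp add: divide_right_mono)
    also have "\<dots> = C\<^sup>2 * (x powr (1 - 2 * \<epsilon>) / x powr 1)" by (simp only: times_divide_eq_right)
    also have "x powr (1 - 2 * \<epsilon>) / x powr 1 = x powr (- (2 * \<epsilon>))"
      by (simp only: powr_diff[symmetric]) simp
    finally show ?thesis .
  qed
  have t1: "real k * real k / real n \<le> C\<^sup>2 * x powr (- (2 * \<epsilon>))"
    using kkx by (simp add: x_def power2_eq_square)
  have t3: "9 * real k * (real Q + 1) ^ 8 / real n \<le> 2304 * C * x powr (- (1 / 4))"
  proof -
    have "9 * real k * (real Q + 1) ^ 8 / x \<le> 9 * (C * x powr (1 / 2 - \<epsilon>)) * (2 * h\<^sup>2) ^ 8 / x"
      using k(3) Q C0 x by (intro divide_right_mono mult_mono power_mono) auto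
    also have "(2 * h\<^sup>2) ^ 8 = 256 * h ^ 16" by (simp add: power_mult_distrib flip: power_mult)
    also have "9 * (C * x powr (1 / 2 - \<epsilon>)) * (256 * h ^ 16) / x
      = 2304 * C * (x powr (1 / 2 - \<epsilon>) * x powr (2 * \<epsilon>) / x powr 1)"
      using x by (simp add: hp)
    also have "x powr (1 / 2 - \<epsilon>) * x powr (2 * \<epsilon>) / x powr 1 = x powr (\<epsilon> - 1 / 2)"
      by (simp only: powr_add[symmetric] powr_diff[symmetric]) (simp add: algebra_simps)
    also have "2304 * C * x powr (\<epsilon> - 1 / 2) \<le> 2304 * C * x powr (- (1 / 4))"
      using x \<epsilon> C0 by (intro mult_left_mono powr_mono) auto
    finally show ?thesis by (simp add: x_def)
  qed
  have t4: "real k * real Q ^ 4 * real k / real n \<le> C\<^sup>2 * x powr (- \<epsilon>)"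
  proof -
    have "real k * real Q ^ 4 * real k / real n = (real k)\<^sup>2 / x * real Q ^ 4"
      by (simp add: x_def power2_eq_square)
    also have "\<dots> \<le> (C\<^sup>2 * x powr (- (2 * \<epsilon>))) * (h\<^sup>2) ^ 4"
      using kkx Q by (intro mult_mono power_mono) auto
    also have "(h\<^sup>2) ^ 4 = x powr \<epsilon>" using hp[of 8] by (simp flip: power_mult)
    also have "C\<^sup>2 * x powr (- (2 * \<epsilon>)) * x powr \<epsilon> = C\<^sup>2 * x powr (- \<epsilon>)"
      by (simp add: mult.assoc powr_add[symmetric])
    finally show ?thesis .
  qed
  have t5: "real n * (2 * real Q * (real k)\<^sup>2 / real n) ^ l \<le> (2 * C\<^sup>2) ^ l * x powr (- (3 / 4))"
  proof -
    have "2 * real Q * (real k)\<^sup>2 / real n = 2 * real Q * ((real k)\<^sup>2 / x)" by (simp add: x_def)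
    also have "\<dots> \<le> 2 * h\<^sup>2 * (C\<^sup>2 * x powr (- (2 * \<epsilon>)))"
      using kkx Q h2 x by (intro mult_mono) auto
    also have "\<dots> = 2 * C\<^sup>2 * (x powr (\<epsilon> / 4) * x powr (- (2 * \<epsilon>)))" using hp[of 2] by simp
    also have "x powr (\<epsilon> / 4) * x powr (- (2 * \<epsilon>)) = x powr (- (7 / 4) * \<epsilon>)"
      by (simp add: powr_add[symmetric])
    finally have "(2 * real Q * (real k)\<^sup>2 / real n) ^ l \<le> (2 * C\<^sup>2 * x powr (- (7 / 4) * \<epsilon>)) ^ l"
      using x by (intro power_mono) (auto simp: x_def)
    also have "\<dots> = (2 * C\<^sup>2) ^ l * x powr (real l * (- (7 / 4) * \<epsilon>))"
      using x by (simp add: power_mult_distrib powr_power)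
    finally have "x * (2 * real Q * (real k)\<^sup>2 / real n) ^ l \<le> x * ((2 * C\<^sup>2) ^ l * x powr (real l * (- (7 / 4) * \<epsilon>)))"
      using x by (intro mult_left_mono) auto
    also have "\<dots> = (2 * C\<^sup>2) ^ l * (x powr 1 * x powr (real l * (- (7 / 4) * \<epsilon>)))" using x by simp
    also have "x powr 1 * x powr (real l * (- (7 / 4) * \<epsilon>)) = x powr (1 + real l * (- (7 / 4) * \<epsilon>))"
      by (simp only: powr_add)
    also have "(2 * C\<^sup>2) ^ l * x powr (1 + real l * (- (7 / 4) * \<epsilon>)) \<le> (2 * C\<^sup>2) ^ l * x powr (- (3 / 4))"
      using x l by (intro mult_left_mono powr_mono) (auto simp: algebra_simps)
    finally show ?thesis by (simp add: x_def)
  qed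
  have hQ: "h / (real Q + 1) \<le> 1 / h"
    using Q(2) h1 by (simp add: divide_le_eq le_divide_eq power2_eq_square) 
  show ?thesis
  proof (cases "real k < 2 * real m * h")
    case True
    have "real k / (real Q + 1) \<le> 2 * real m * (h / (real Q + 1))"
      using True by (simp add: divide_right_mono)
    also have "\<dots> \<le> 2 * real m * (1 / h)" using hQ by (intro mult_left_mono) auto
    also have "\<dots> \<le> 8 * real m * x powr (- (\<epsilon> / 8))" unfolding hinv by simp
    finally have t2: "real k / (real Q + 1) \<le> 8 * real m * x powr (- (\<epsilon> / 8))" .
    have "0 \<le> real (m + 1) * x powr (- (\<epsilon> / 8))" by simp
    then show ?thesis using prob_recovered_small[OF k(1,2), of Q l] t1 t2 t3 t4 t5 by linarith
  next
    case False
    \<comment> \<open>A block of this length receives about \<open>h\<close> elements on average, so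
      it is missed with probability at most \<open>exp (- h)\<close>, while a window of a constant
      number of blocks receives more than \<open>Q\<close> with probability of order
      \<open>1 / h\<close>. The case assumption on \<open>k\<close> makes the \<open>m\<close>
      blocks fit into the range.\<close>
    define b where "b = nat \<lceil>x * h / real k\<rceil>"
    have pos: "0 < x * h / real k" using x h1 k by simp
    have b: "x * h / real k \<le> real b" "real b \<le> x * h / real k + 1" unfolding b_def using pos by linarith+
    then have b0: "0 < b" using pos by (metis less_le_trans of_nat_0_less_iff)
    have "real m * (x * h / real k) \<le> x / 2"
    proof -
      have "2 * real m * h * x \<le> real k * x" using False x by (intro mult_right_mono) auto
      then show ?thesis using k by (simp add: field_simps)
    qed
    moreover have "real m * real b \<le> real m * (x * h / real k) + real m"
      using mult_left_mono[OF b(2), of "real m"] by (simp add: distrib_left)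
    ultimately have "real m * real b \<le> x / 2 + real m" by linarith
    also have "\<dots> \<le> x" using n unfolding x_def by simp
    finally have mb: "m * b \<le> n" unfolding x_def by (simp flip: of_nat_mult)
    have kb: "real k * real b \<le> 2 * (x * h)"
    proof -
      have "real k * real b \<le> real k * (x * h / real k + 1)" using b(2) by (intro mult_left_mono) auto
      also have "\<dots> = x * h + real k" using k by (simp add: distrib_left)
      also have "real k \<le> x * h" using k(2) mult_left_mono[OF h1, of x] x unfolding x_def by linarith
      finally show ?thesis by (simp only: mult_2)
    qed
    have "real k * real (4 * m * b) / (real n * (real Q + 1)) = 4 * real m * (real k * real b) / (x * (real Q + 1))"
      by (simp add: x_def)
    also have "\<dots> \<le> 4 * real m * (2 * (x * h)) / (x * (real Q + 1))"
      using kb x by (intro divide_right_mono mult_left_mono) auto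
    also have "\<dots> = 8 * real m * (h / (real Q + 1))" using x by simp
    also have "\<dots> \<le> 8 * real m * (1 / h)" using hQ by (intro mult_left_mono) auto
    finally have t2: "real k * real (4 * m * b) / (real n * (real Q + 1)) \<le> 8 * real m * x powr (- (\<epsilon> / 8))"
      unfolding hinv .
    have "(1 - real b / real n) ^ k \<le> 1 / h"
    proof -
      have "b \<le> n" using mb m0 by (cases m) auto
      then have "0 \<le> 1 - real b / real n" using k by simp
      then have "(1 - real b / real n) ^ k \<le> exp (- (real b / real n)) ^ k"
        using exp_ge_add_one_self[of "- (real b / real n)"] by (intro power_mono) auto
      also have "\<dots> = exp (- (real k * real b / x))" by (simp add: exp_of_nat_mult[symmetric] x_def)
      also have "\<dots> \<le> exp (- h)"
        using b(1) k x by (simp add: field_simps)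
      also have "\<dots> = 1 / exp h" by (simp add: exp_minus inverse_eq_divide)
      also have "\<dots> \<le> 1 / h"
      proof (rule divide_left_mono)
        show "h \<le> exp h" using exp_ge_add_one_self[of h] by linarith
      qed (use h1 in auto)
      finally show ?thesis .
    qed
    then have t6: "real (m + 1) * (1 - real b / real n) ^ k \<le> real (m + 1) * x powr (- (\<epsilon> / 8))"
      unfolding hinv by (intro mult_left_mono) auto
    show ?thesis using prob_recovered_large[OF k(1,2) b0 mb m, of Q] t1 t2 t3 t4 t5 t6 by linarith
  qed
qed

lemma prob_recovered_0: "measure_pmf.prob (random_subset n 0) {V. recovered n 0 V} = 1"
proof -
  have "{V :: int set. V \<subseteq> {0..<int n} \<and> card V = 0} = {{}}"
    using finite_subset by (auto simp: card_eq_0_iff)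
  then have "random_subset n 0 = return_pmf {}" unfolding random_subset_def by (simp add: pmf_of_set_singleton)
  moreover have "recovered n 0 {}" by (rule recovered_trivial) auto
  ultimately show ?thesis by simp
qed

lemma recovered_with_high_probability:
  fixes \<epsilon> \<delta> :: real and k :: "nat \<Rightarrow> nat"
  assumes \<epsilon>: "0 < \<epsilon>" and \<delta>: "0 < \<delta>" and k: "(\<lambda>n. real (k n)) \<in> O(\<lambda>n. real n powr (1 / 2 - \<epsilon>))"
  shows "\<exists>N. \<forall>n>N. measure_pmf.prob (random_subset n (k n)) {V. recovered n (k n) V} > 1 - \<delta>"
proof -
  \<comment> \<open>A smaller exponent only weakens the growth condition; the cap
    \<open>1 / 4\<close> keeps the four-term error decaying.\<close>
  define \<epsilon>' where "\<epsilon>' = min \<epsilon> (1 / 4)"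
  have \<epsilon>': "0 < \<epsilon>'" "\<epsilon>' \<le> 1 / 4" "\<epsilon>' \<le> \<epsilon>" using \<epsilon> by (auto simp: \<epsilon>'_def)
  obtain C where C: "0 < C" "eventually (\<lambda>n. norm (real (k n)) \<le> C * norm (real n powr (1 / 2 - \<epsilon>))) at_top"
    using landau_o.bigE[OF k] by blast
  define l where "l = nat \<lceil>1 / \<epsilon>'\<rceil>"
  have "1 / \<epsilon>' \<le> real l" unfolding l_def by linarith
  then have l: "1 \<le> \<epsilon>' * real l" using \<epsilon>' by (simp add: field_simps)
  define m where "m = (3 * l)\<^sup>2 + 6 * l + 2"
  define g where "g = (\<lambda>x. C\<^sup>2 * x powr (- (2 * \<epsilon>')) + 8 * real m * x powr (- (\<epsilon>' / 8)) + 2304 * C * x powr (- (1 / 4))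
      + C\<^sup>2 * x powr (- \<epsilon>') + (2 * C\<^sup>2) ^ l * x powr (- (3 / 4)) + real (m + 1) * x powr (- (\<epsilon>' / 8)))"
  have decay: "((\<lambda>n. c * real n powr (- a)) \<longlongrightarrow> 0) at_top" if "0 < a" for c a :: real
    by (rule tendsto_mult_right_zero, rule tendsto_neg_powr) (use that filterlim_real_sequentially in auto)
  have "((\<lambda>n. g (real n)) \<longlongrightarrow> 0 + 0 + 0 + 0 + 0 + 0) at_top"
    unfolding g_def by (intro tendsto_add decay) (use \<epsilon>' in auto)
  then have "eventually (\<lambda>n. g (real n) < \<delta>) at_top" using \<delta> by (intro order_tendstoD(2)) auto
  \<comment> \<open>This yields \<open>k n \<le> n\<close>, so that there are subsets to choose
    from.\<close>
  moreover have "eventually (\<lambda>n. C * real n powr (- (1 / 2)) < 1) at_top"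
    using decay[of "1 / 2" C] by (intro order_tendstoD(2)[of _ 0]) auto
  moreover have "eventually (\<lambda>n. 2 * m \<le> n) at_top" by (rule eventually_ge_at_top)
  ultimately have "eventually (\<lambda>n. measure_pmf.prob (random_subset n (k n)) {V. recovered n (k n) V} > 1 - \<delta>) at_top"
    using C(2)
  proof eventually_elim
    case (elim n)
    have n1: "1 \<le> real n" using elim(3) by (simp add: m_def)
    have "real (k n) \<le> C * real n powr (1 / 2 - \<epsilon>)" using elim(4) by simp
    also have "\<dots> \<le> C * real n powr (1 / 2 - \<epsilon>')"
      using C(1) n1 \<epsilon>' by (intro mult_left_mono powr_mono) auto
    finally have kn: "real (k n) \<le> C * real n powr (1 / 2 - \<epsilon>')" .
    also have "\<dots> \<le> C * real n powr (1 / 2)" using C(1) n1 \<epsilon>' by (intro mult_left_mono powr_mono) auto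
    also have "\<dots> = real n * (C * real n powr (- (1 / 2)))"
    proof -
      have "real n powr (1 / 2) = real n powr 1 * real n powr (- (1 / 2))"
        by (simp only: powr_add[symmetric]) simp
      then show ?thesis using n1 by simp
    qed
    also have "\<dots> \<le> real n * 1" using elim(2) by (intro mult_left_mono) auto
    finally have kle: "k n \<le> n" by simp
    show ?case
    proof (cases "k n = 0")
      case True
      then show ?thesis using prob_recovered_0[of n] \<delta> by simp
    next
      case False
      then have "1 - g (real n) \<le> measure_pmf.prob (random_subset n (k n)) {V. recovered n (k n) V}"
        unfolding g_def using elim(3) kn kle \<epsilon>' l
        by (intro prob_recovered_asymptotic) (auto simp: m_def)
      with elim(1) show ?thesis by linarith
    qed
  qed
  then obtain N where "\<And>n. n \<ge> N \<Longrightarrow> measure_pmf.prob (random_subset n (k n)) {V. recovered n (k n) V} > 1 - \<delta>"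
    unfolding eventually_at_top_linorder by blast
  then show ?thesis by (intro exI[of _ N]) auto
qed

theorem theorem1:
  "\<exists>(A :: com) (p :: nat poly).
     (\<forall>(V :: int set) (n :: nat).
        finite V \<and> (\<forall>w \<in> dist_set V. w \<le> int n) \<longrightarrow>
        halts_within A (input_memory n (card V) (dist_set V)) (poly p n)) \<and>
     (\<forall>(\<epsilon> :: real) (\<delta> :: real) (k :: nat \<Rightarrow> nat).
        \<epsilon> > 0 \<and> \<delta> > 0 \<and> (\<lambda>n. real (k n)) \<in> O(\<lambda>n. real n powr (1 / 2 - \<epsilon>)) \<longrightarrow>
        (\<exists>N :: nat. \<forall>n > N.
           measure_pmf.prob (random_subset n (k n))
             {V. uniquely_recoverable V \<and>
                 (\<exists>X. outputs A (input_memory n (k n) (dist_set V)) X \<and> shift_reflect V X)}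
           > 1 - \<delta>))"
proof (intro exI[of _ recover] exI[of _ "[:20, 45, 20:] :: nat poly"] conjI allI impI)
  fix V :: "int set" and n :: nat
  assume "finite V \<and> (\<forall>w\<in>dist_set V. w \<le> int n)"
  then have "finite (dist_set V)" "dist_set V \<subseteq> {0..int n}"
    using finite_dist_set dist_set_nonneg by auto
  from halts_recover[OF this, of "card V"]
  show "halts_within recover (input_memory n (card V) (dist_set V)) (poly [:20, 45, 20:] n)"
    by (simp add: algebra_simps)
next
  fix \<epsilon> \<delta> :: real and k :: "nat \<Rightarrow> nat"
  assume "\<epsilon> > 0 \<and> \<delta> > 0 \<and> (\<lambda>n. real (k n)) \<in> O(\<lambda>n. real n powr (1 / 2 - \<epsilon>))"
  then show "\<exists>N. \<forall>n>N. measure_pmf.prob (random_subset n (k n))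
      {V. uniquely_recoverable V \<and>
          (\<exists>X. outputs recover (input_memory n (k n) (dist_set V)) X \<and> shift_reflect V X)} > 1 - \<delta>"
    using recovered_with_high_probability unfolding recovered_def by blast
qed

end
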